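(* There is an absolute constant $C>0$ such that the following holds. Let $\mathcal{F}$ be a system of $m$ sets on $[n]$ such that $\mathcal{F} = \mathcal{F}_1 \cup \mathcal{F}_2 \cup \cdots \cup \mathcal{F}_t$ for set systems $\mathcal{F}_1,\dots,\mathcal{F}_t$ on $[n]$. Then $$\mathsf{herdisc}(\mathcal{F}) \leq C \sqrt{ t \log (m) \log (n) } \cdot \max_{i \in [t]} \mathsf{herdisc}(\mathcal{F}_i).$$
   Context: For a matrix $A\in\mathbb{R}^{m\times n}$, $\mathsf{disc}(A) := \min_{\mathbf{x} \in \{-1,+1\}^n} \|A \mathbf{x}\|_\infty$ and $\mathsf{herdisc}(A) := \max_{S \subseteq [n]} \mathsf{disc}(A_S)$, where $A_S$ is the restriction of $A$ to the columns in $S$. For a set system $\mathcal{F}$ on $[n]$, $\mathsf{herdisc}(\mathcal{F}) := \mathsf{herdisc}(A_\mathcal{F})$, where $A_{\mathcal{F}}\in\{0,1\}^{|\mathcal{F}|\times n}$ is the incidence matrix of $\mathcal{F}$ (rows indexed by sets, columns by elements).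
   Formalization: The formal theorem assumes m ≥ 2, n ≥ 2 and t ≥ 1: for m = 1 (F = {[n]}) or n = 1 (F = {∅,{1}}) the right-hand side is 0 while herdisc(F) = 1, and for m = 0, n = 0 or t = 0 the logarithm or the maximum is undefined. *)

theory Defs
  imports Complex_Main "HOL-Library.FuncSet"
begin

text \<open>A real matrix is a function \<open>A\<close> of a row and a column index, together with a finite set
  \<open>I\<close> of row indices and a finite set \<open>J\<close> of column indices; the restriction of the matrix to the
  columns in \<open>S\<close> is obtained by replacing \<open>J\<close> with \<open>S\<close>.\<close>

text \<open>Inserting \<open>0\<close> only matters for \<open>I = {}\<close>: the norm on the zero-dimensional space is \<open>0\<close>.\<close>

definition linf_norm :: "'r set \<Rightarrow> ('r \<Rightarrow> real) \<Rightarrow> real" where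
  "linf_norm I v = Max (insert 0 ((\<lambda>i. \<bar>v i\<bar>) ` I))"

definition mat_apply :: "'c set \<Rightarrow> ('r \<Rightarrow> 'c \<Rightarrow> real) \<Rightarrow> ('c \<Rightarrow> real) \<Rightarrow> 'r \<Rightarrow> real" where
  "mat_apply J A x = (\<lambda>i. \<Sum>j\<in>J. A i j * x j)"

definition disc :: "'r set \<Rightarrow> 'c set \<Rightarrow> ('r \<Rightarrow> 'c \<Rightarrow> real) \<Rightarrow> real" where
  "disc I J A = Min ((\<lambda>x. linf_norm I (mat_apply J A x)) ` (J \<rightarrow>\<^sub>E {-1, 1}))"

definition herdisc :: "'r set \<Rightarrow> 'c set \<Rightarrow> ('r \<Rightarrow> 'c \<Rightarrow> real) \<Rightarrow> real" where
  "herdisc I J A = Max ((\<lambda>S. disc I S A) ` Pow J)"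

definition incidence :: "'c set \<Rightarrow> 'c \<Rightarrow> real" where
  "incidence X j = (if j \<in> X then 1 else 0)"

definition set_system_on :: "nat \<Rightarrow> nat set set \<Rightarrow> bool" where
  "set_system_on n F \<longleftrightarrow> F \<subseteq> Pow {1..n}"

definition herdisc_sets :: "nat \<Rightarrow> nat set set \<Rightarrow> real" where
  "herdisc_sets n F = herdisc F {1..n} incidence"

end

theory Submission
  imports Defs "HOL-Combinatorics.Permutations"
begin

text \<open>
  A colouring is built by a walk in the cube whose steps are orthogonal to the current position \<open>y\<close>
  and whose signs keep \<open>\<Phi>(y) = \<Sum>\<^sub>j cosh (\<eta> a\<^sub>j\<cdot>y)\<close> small. A step \<open>x\<close> multiplies \<open>\<Phi>\<close> by at most
  \<open>1 + \<eta>\<^sup>2 M(x)/W\<close>, where \<open>M = \<Sum>\<^sub>j w\<^sub>j a\<^sub>j a\<^sub>j\<^sup>T\<close>, \<open>w\<^sub>j = cosh (\<eta> a\<^sub>j\<cdot>y)\<close> and \<open>W = \<Sum>\<^sub>j w\<^sub>j\<close>. If among \<open>k\<close>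
  unfrozen coordinates there is always a direction with \<open>M(x) \<le> O(t d\<^sup>2) W |x|\<^sup>2 / k\<close>, the total
  growth exponent is \<open>O(\<eta>\<^sup>2 t d\<^sup>2 log n)\<close>, and optimising \<open>\<eta>\<close> gives the bound.

  Such a direction exists because \<open>det (1 + M)\<close> is small. If the \<open>i\<close>-th system has hereditary discrepancy
  at most \<open>d\<close>, rounding dyadic points bit by bit produces many lattice points at which its part \<open>M\<^sub>i\<close> of
  the form is small; comparing with a Gaussian lattice sum bounds every principal minor of \<open>M\<^sub>i\<close> on
  \<open>s\<close> coordinates by \<open>(O(d\<^sup>2 W\<^sub>i)/s)\<^sup>s\<close>, so \<open>det (1 + M\<^sub>i) \<le> exp (O(\<surd>(k d\<^sup>2 W\<^sub>i)))\<close>. Fischer's inequality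
  makes \<open>det (1 + M)\<close> submultiplicative, and Cauchy--Schwarz over the \<open>t\<close> systems costs only \<open>\<surd>t\<close>.
\<close>

section \<open>Determinants over finite index sets\<close>

text \<open>The index set is a set rather than a type, because principal minors and Schur complements
  change it inside a proof.\<close>

definition Det :: "'a set \<Rightarrow> ('a \<Rightarrow> 'a \<Rightarrow> real) \<Rightarrow> real" where
  "Det I P = (\<Sum>p | p permutes I. of_int (sign p) * (\<Prod>i\<in>I. P i (p i)))"

text \<open>The result keeps the index type and is meant to be read only on the index set without
  \<open>i\<close>; the pivot row and column become zero when \<open>P i i\<close> is
  nonzero.\<close>

definition schur :: "'a \<Rightarrow> ('a \<Rightarrow> 'a \<Rightarrow> real) \<Rightarrow> 'a \<Rightarrow> 'a \<Rightarrow> real" where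
  "schur i P = (\<lambda>j l. P j l - P j i * P i l / P i i)"

lemma Det_cong:
  assumes "\<And>i j. i \<in> I \<Longrightarrow> j \<in> I \<Longrightarrow> P i j = Q i j"
  shows "Det I P = Det I Q"
  unfolding Det_def
  by (intro sum.cong refl arg_cong2[where f="(*)"] prod.cong)
     (auto simp: assms permutes_in_image)

lemma Det_empty [simp]: "Det {} P = 1"
  by (simp add: Det_def)

lemma Det_row_add:
  assumes "finite I" "r \<in> I"
  shows "Det I (P(r := (\<lambda>l. a l + c * b l))) = Det I (P(r := a)) + c * Det I (P(r := b))"
proof -
  have *: "(\<Prod>i\<in>I. (P(r := f)) i (p i)) = f (p r) * (\<Prod>i\<in>I - {r}. P i (p i))" for f p
    using assms by (simp add: prod.remove)
  show ?thesis
    unfolding Det_def * by (simp add: sum.distrib[symmetric] sum_distrib_left algebra_simps)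
qed

text \<open>Composing with the transposition of \<open>r\<close> and \<open>s\<close> permutes the
  summands, flips each sign and keeps each product, so the determinant equals its own
  negative.\<close>

lemma Det_equal_rows:
  assumes "finite I" "r \<in> I" "s \<in> I" "r \<noteq> s" "\<And>l. l \<in> I \<Longrightarrow> P r l = P s l"
  shows "Det I P = 0"
proof -
  let ?t = "transpose r s"
  let ?f = "\<lambda>p. of_int (sign p) * (\<Prod>i\<in>I. P i (p i)) :: real"
  have t: "?t permutes I"
    using assms by (simp add: permutes_swap_id)
  have neg: "?f (p \<circ> ?t) = - ?f p" if p: "p permutes I" for p
  proof -
    have "sign (p \<circ> ?t) = - sign p"
      using assms(1,4) p permutation_permutes[of p]
      by (subst sign_compose) (auto simp: permutation_swap_id sign_swap_id)
    moreover have "(\<Prod>i\<in>I. P i ((p \<circ> ?t) i)) = (\<Prod>i\<in>I. P (?t i) (p i))"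
      using prod.permute[OF t, of "\<lambda>i. P (?t i) (p i)"] by (simp add: comp_def)
    moreover have "(\<Prod>i\<in>I. P (?t i) (p i)) = (\<Prod>i\<in>I. P i (p i))"
    proof (rule prod.cong[OF refl])
      fix i assume "i \<in> I"
      then have "p i \<in> I" using p by (simp add: permutes_in_image)
      then show "P (?t i) (p i) = P i (p i)"
        using assms by (auto simp: transpose_def)
    qed
    ultimately show ?thesis by simp
  qed
  have "Det I P = (\<Sum>p | p permutes I. ?f (p \<circ> ?t))"
    unfolding Det_def by (rule sum.reindex_bij_witness[of _ "\<lambda>p. p \<circ> ?t" "\<lambda>p. p \<circ> ?t"])
      (auto simp: comp_assoc intro: permutes_compose[OF t])
  also have "\<dots> = - Det I P"
    unfolding Det_def sum_negf[symmetric] by (rule sum.cong) (simp_all only: neg mem_Collect_eq)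
  finally show ?thesis by simp
qed

lemma Det_add_row_multiple:
  assumes "finite I" "r \<in> I" "s \<in> I" "r \<noteq> s"
  shows "Det I (P(r := (\<lambda>l. P r l + c * P s l))) = Det I P"
proof -
  have "Det I (P(r := P s)) = 0"
    using assms by (intro Det_equal_rows[of I r s]) auto
  then show ?thesis
    using Det_row_add[OF assms(1,2), of P "P r" c "P s"] by simp
qed

lemma Det_zero_row:
  assumes "finite I" "r \<in> I" "\<And>l. l \<in> I \<Longrightarrow> P r l = 0"
  shows "Det I P = 0"
  unfolding Det_def
proof (rule sum.neutral, rule ballI)
  fix p assume "p \<in> {p. p permutes I}"
  then have "P r (p r) = 0" using assms by (auto simp: permutes_in_image)
  then show "of_int (sign p) * (\<Prod>i\<in>I. P i (p i)) = 0"
    using assms by (auto intro!: prod_zero)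
qed

text \<open>A permutation that moves \<open>i\<close> sends some \<open>j\<close> in
  \<open>I\<close> to \<open>i\<close> and so meets a zero entry; only permutations of
  \<open>I\<close> contribute.\<close>

lemma Det_clear_column:
  assumes "finite I" "i \<notin> I" "\<And>j. j \<in> I \<Longrightarrow> P j i = 0"
  shows "Det (insert i I) P = P i i * Det I P"
proof -
  let ?f = "\<lambda>p. of_int (sign p) * (\<Prod>j\<in>insert i I. P j (p j)) :: real"
  have "Det (insert i I) P = sum ?f {p. p permutes I}"
    unfolding Det_def
  proof (rule sum.mono_neutral_right)
    show "finite {p. p permutes insert i I}" using assms by (simp add: finite_permutations)
    show "{p. p permutes I} \<subseteq> {p. p permutes insert i I}"
      by (auto intro: permutes_subset)
    show "\<forall>p\<in>{p. p permutes insert i I} - {p. p permutes I}. ?f p = 0"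
    proof
      fix p assume p: "p \<in> {p. p permutes insert i I} - {p. p permutes I}"
      then have pi: "p permutes insert i I" "\<not> p permutes I" by auto
      have "p i \<noteq> i"
      proof
        assume "p i = i"
        with pi(1) have "p permutes I"
          by (intro permutes_superset[OF pi(1)]) auto
        with pi(2) show False by simp
      qed
      moreover obtain j where j: "p j = i" using pi(1) by (metis permutes_surj surjD)
      ultimately have "j \<noteq> i" by auto
      then have "j \<in> I" using pi(1) j by (metis insertE insertI1 permutes_in_image)
      then have "P j (p j) = 0" using j assms by simp
      then show "?f p = 0" using \<open>j \<in> I\<close> assms by (auto intro!: prod_zero)
    qed
  qed
  also have "\<dots> = (\<Sum>p | p permutes I. P i i * (of_int (sign p) * (\<Prod>j\<in>I. P j (p j))))"
  proof (rule sum.cong[OF refl])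
    fix p assume "p \<in> {p. p permutes I}"
    then have "p i = i" using assms by (auto simp: permutes_not_in)
    then show "?f p = P i i * (of_int (sign p) * (\<Prod>j\<in>I. P j (p j)))"
      using assms by simp
  qed
  finally show ?thesis by (simp add: Det_def sum_distrib_left)
qed

text \<open>One step of Gaussian elimination: subtracting multiples of row \<open>i\<close> clears
  column \<open>i\<close> and does not change the determinant. This is the recursion behind the
  later inductions on the index set.\<close>

lemma Det_schur:
  assumes "finite I" "i \<notin> I" "P i i \<noteq> 0"
  shows "Det (insert i I) P = P i i * Det I (schur i P)"
proof -
  \<comment> \<open>\<open>R T\<close> is the matrix in which exactly the rows in \<open>T\<close>
    have been eliminated, so induction on \<open>T\<close> changes one row at a time.\<close>
  define R where "R T = (\<lambda>j. if j \<in> T then schur i P j else P j)" for T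
  have "Det (insert i I) (R T) = Det (insert i I) P" if "T \<subseteq> I" for T
    using finite_subset[OF that assms(1)] that
  proof (induction T rule: finite_induct)
    case empty
    then show ?case by (simp add: R_def)
  next
    case (insert j T)
    have "R (insert j T) = (R T)(j := (\<lambda>l. R T j l + (- (P j i / P i i)) * R T i l))"
      using insert assms by (auto simp: R_def schur_def fun_eq_iff)
    moreover have "Det (insert i I) ((R T)(j := (\<lambda>l. R T j l + (- (P j i / P i i)) * R T i l))) = Det (insert i I) (R T)"
      using insert assms by (intro Det_add_row_multiple) auto
    ultimately have "Det (insert i I) (R (insert j T)) = Det (insert i I) (R T)" by (simp only:)
    then show ?case using insert by simp
  qed
  from this[of I] have "Det (insert i I) P = Det (insert i I) (R I)" by simp
  also have "\<dots> = R I i i * Det I (R I)"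
    using assms by (intro Det_clear_column) (auto simp: R_def schur_def)
  also have "R I i i = P i i" using assms by (simp add: R_def)
  also have "Det I (R I) = Det I (schur i P)" by (rule Det_cong) (simp add: R_def)
  finally show ?thesis .
qed

lemma Det_scale:
  assumes "finite I"
  shows "Det I (\<lambda>i j. c * P i j) = c ^ card I * Det I P"
  unfolding Det_def by (simp add: prod.distrib sum_distrib_left algebra_simps)

text \<open>Expand each product over the set \<open>S\<close> of indices at which the factor from
  \<open>P\<close> is chosen. The remaining factors vanish unless the permutation fixes every point
  outside \<open>S\<close>, which leaves a principal minor.\<close>

lemma Det_add_identity:
  assumes "finite I"
  shows "Det I (\<lambda>i j. of_bool (i = j) + P i j) = (\<Sum>S\<in>Pow I. Det S P)"
proof -
  have "Det I (\<lambda>i j. of_bool (i = j) + P i j)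
      = (\<Sum>p | p permutes I. \<Sum>S\<in>Pow I. of_int (sign p) *
          ((\<Prod>i\<in>S. P i (p i)) * (\<Prod>i\<in>I - S. of_bool (i = p i))))"
    unfolding Det_def using assms
    by (intro sum.cong refl) (simp add: add.commute prod_add sum_distrib_left)
  also have "\<dots> = (\<Sum>S\<in>Pow I. \<Sum>p | p permutes I. of_int (sign p) *
          ((\<Prod>i\<in>S. P i (p i)) * (\<Prod>i\<in>I - S. of_bool (i = p i))))"
    by (rule sum.swap)
  also have "\<dots> = (\<Sum>S\<in>Pow I. Det S P)"
  proof (rule sum.cong[OF refl])
    fix S assume "S \<in> Pow I"
    then have S: "S \<subseteq> I" by simp
    let ?f = "\<lambda>p. of_int (sign p) *
          ((\<Prod>i\<in>S. P i (p i)) * (\<Prod>i\<in>I - S. of_bool (i = p i))) :: real"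
    have "(\<Sum>p | p permutes I. ?f p) = (\<Sum>p | p permutes S. ?f p)"
    proof (rule sum.mono_neutral_right)
      show "finite {p. p permutes I}" using assms by (simp add: finite_permutations)
      show "{p. p permutes S} \<subseteq> {p. p permutes I}" using S by (auto intro: permutes_subset)
      show "\<forall>p\<in>{p. p permutes I} - {p. p permutes S}. ?f p = 0"
      proof
        fix p assume "p \<in> {p. p permutes I} - {p. p permutes S}"
        then have p: "p permutes I" "\<not> p permutes S" by auto
        then obtain i where "i \<in> I - S" "p i \<noteq> i"
          using permutes_superset[OF p(1), of S] by blast
        then have "(\<Prod>i\<in>I - S. of_bool (i = p i) :: real) = 0"
          using assms by (intro prod_zero) (auto intro!: bexI[of _ i])
        then show "?f p = 0" by simp
      qed
    qed
    also have "\<dots> = Det S P"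
      unfolding Det_def
    proof (rule sum.cong[OF refl])
      fix p assume "p \<in> {p. p permutes S}"
      then have "(\<Prod>i\<in>I - S. of_bool (i = p i) :: real) = 1"
        by (intro prod.neutral) (auto simp: permutes_not_in)
      then show "?f p = of_int (sign p) * (\<Prod>i\<in>S. P i (p i))" by simp
    qed
    finally show "(\<Sum>p | p permutes I. ?f p) = Det S P" .
  qed
  finally show ?thesis .
qed

section \<open>Positive semidefinite forms\<close>

definition qf :: "'a set \<Rightarrow> ('a \<Rightarrow> 'a \<Rightarrow> real) \<Rightarrow> ('a \<Rightarrow> real) \<Rightarrow> real" where
  "qf I P x = (\<Sum>i\<in>I. \<Sum>j\<in>I. P i j * x i * x j)"

definition symm_on :: "'a set \<Rightarrow> ('a \<Rightarrow> 'a \<Rightarrow> real) \<Rightarrow> bool" where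
  "symm_on I P \<longleftrightarrow> (\<forall>i\<in>I. \<forall>j\<in>I. P i j = P j i)"

definition psd :: "'a set \<Rightarrow> ('a \<Rightarrow> 'a \<Rightarrow> real) \<Rightarrow> bool" where
  "psd I P \<longleftrightarrow> symm_on I P \<and> (\<forall>x. 0 \<le> qf I P x)"

text \<open>Vectors are functions on the whole type, so being nonzero has to be asked for on
  \<open>I\<close>.\<close>

definition pd :: "'a set \<Rightarrow> ('a \<Rightarrow> 'a \<Rightarrow> real) \<Rightarrow> bool" where
  "pd I P \<longleftrightarrow> symm_on I P \<and> (\<forall>x. (\<exists>i\<in>I. x i \<noteq> 0) \<longrightarrow> 0 < qf I P x)"

lemma symm_onD: "symm_on I P \<Longrightarrow> i \<in> I \<Longrightarrow> j \<in> I \<Longrightarrow> P i j = P j i"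
  by (auto simp: symm_on_def)

lemma pdD: "pd I P \<Longrightarrow> i \<in> I \<Longrightarrow> x i \<noteq> 0 \<Longrightarrow> 0 < qf I P x"
  by (auto simp: pd_def)

lemma qf_cong: "(\<And>i. i \<in> I \<Longrightarrow> x i = y i) \<Longrightarrow> qf I P x = qf I P y"
  unfolding qf_def by (intro sum.cong refl) simp

lemma qf_empty [simp]: "qf {} P x = 0"
  by (simp add: qf_def)

lemma qf_zero: "(\<And>i. i \<in> I \<Longrightarrow> x i = 0) \<Longrightarrow> qf I P x = 0"
  by (simp add: qf_def)

lemma qf_superset:
  assumes "finite B" "A \<subseteq> B" "\<And>i. i \<in> B - A \<Longrightarrow> x i = 0"
  shows "qf B P x = qf A P x"
proof -
  have "qf B P x = (\<Sum>i\<in>A. \<Sum>j\<in>B. P i j * x i * x j)"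
    unfolding qf_def using assms by (intro sum.mono_neutral_right) auto
  also have "\<dots> = qf A P x"
    unfolding qf_def using assms by (intro sum.cong refl sum.mono_neutral_right) auto
  finally show ?thesis .
qed

lemma qf_insert:
  assumes "finite I" "i \<notin> I" "symm_on (insert i I) P"
  shows "qf (insert i I) P x = P i i * (x i)\<^sup>2 + 2 * x i * (\<Sum>j\<in>I. P i j * x j) + qf I P x"
proof -
  have "(\<Sum>j\<in>I. P j i * x j * x i) = x i * (\<Sum>j\<in>I. P i j * x j)"
    unfolding sum_distrib_left by (intro sum.cong) (simp_all add: symm_onD[OF assms(3), of _ i])
  moreover have "(\<Sum>j\<in>I. P i j * x i * x j) = x i * (\<Sum>j\<in>I. P i j * x j)"
    unfolding sum_distrib_left by (intro sum.cong) auto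
  ultimately show ?thesis
    using assms by (simp add: qf_def sum.distrib power2_eq_square)
qed

lemma qf_schur_diff:
  assumes "finite I" "symm_on (insert i I) P"
  shows "qf I (schur i P) x = qf I P x - (\<Sum>j\<in>I. P i j * x j)\<^sup>2 / P i i"
proof -
  have "qf I (schur i P) x = (\<Sum>j\<in>I. \<Sum>l\<in>I. P j l * x j * x l - (P i j * x j) * (P i l * x l) / P i i)"
    unfolding qf_def schur_def
  proof (intro sum.cong refl)
    fix j l assume "j \<in> I"
    then have ji: "P j i = P i j" by (intro symm_onD[OF assms(2)]) auto
    show "(P j l - P j i * P i l / P i i) * x j * x l = P j l * x j * x l - P i j * x j * (P i l * x l) / P i i"
      unfolding ji by (simp add: algebra_simps)
  qed
  also have "\<dots> = qf I P x - (\<Sum>j\<in>I. P i j * x j)\<^sup>2 / P i i"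
    unfolding qf_def power2_eq_square
    by (simp add: sum_subtractf sum_product sum_divide_distrib)
  finally show ?thesis .
qed

text \<open>Completing the square in the coordinate \<open>x i\<close>.\<close>

lemma qf_insert_schur:
  assumes "finite I" "i \<notin> I" "symm_on (insert i I) P" "P i i \<noteq> 0"
  shows "qf (insert i I) P x
       = P i i * (x i + (\<Sum>j\<in>I. P i j * x j) / P i i)\<^sup>2 + qf I (schur i P) x"
  unfolding qf_insert[OF assms(1-3)] qf_schur_diff[OF assms(1,3)]
  using assms(4) by (simp add: field_simps power2_eq_square)

text \<open>The value substituted at \<open>i\<close> makes the completed square vanish. For a
  positive pivot it minimises the form in that coordinate, so the Schur complement is a partial
  minimum.\<close>

lemma qf_schur:
  assumes "finite I" "i \<notin> I" "symm_on (insert i I) P" "P i i \<noteq> 0"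
  shows "qf I (schur i P) x = qf (insert i I) P (x(i := - (\<Sum>j\<in>I. P i j * x j) / P i i))"
proof -
  have "(\<Sum>j\<in>I. P i j * (x(i := c)) j) = (\<Sum>j\<in>I. P i j * x j)" for c
    using assms by (intro sum.cong) auto
  moreover have "qf I (schur i P) (x(i := c)) = qf I (schur i P) x" for c
    using assms by (intro qf_cong) auto
  ultimately show ?thesis
    unfolding qf_insert_schur[OF assms] by simp
qed

lemma qf_schur_le:
  assumes "finite I" "i \<notin> I" "symm_on (insert i I) P" "P i i > 0"
  shows "qf I (schur i P) x \<le> qf (insert i I) P (x(i := c))"
proof -
  have "qf I (schur i P) (x(i := c)) = qf I (schur i P) x"
    using assms by (intro qf_cong) auto
  then show ?thesis
    using qf_insert_schur[OF assms(1-3), of "x(i := c)"] assms(4) by simp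
qed

lemma qf_unit:
  assumes "finite I" "i \<in> I"
  shows "qf I P (\<lambda>j. of_bool (j = i)) = P i i"
  using assms by (subst qf_superset[of I "{i}"]) (auto simp: qf_def)

lemma symm_on_subset: "symm_on B P \<Longrightarrow> A \<subseteq> B \<Longrightarrow> symm_on A P"
  by (auto simp: symm_on_def)

lemma symm_on_schur: "symm_on (insert i I) P \<Longrightarrow> symm_on I (schur i P)"
  unfolding symm_on_def schur_def by (metis insert_iff mult.commute)

lemma pd_imp_psd: "pd I P \<Longrightarrow> psd I P"
  unfolding pd_def psd_def by (metis less_eq_real_def qf_zero)

lemma pd_diag: "pd I P \<Longrightarrow> finite I \<Longrightarrow> i \<in> I \<Longrightarrow> 0 < P i i"
  unfolding pd_def by (metis (mono_tags, lifting) of_bool_eq(2) qf_unit zero_neq_one)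

lemma psd_diag: "psd I P \<Longrightarrow> finite I \<Longrightarrow> i \<in> I \<Longrightarrow> 0 \<le> P i i"
  unfolding psd_def by (metis qf_unit)

lemma pd_subset:
  assumes "pd B P" "finite B" "A \<subseteq> B"
  shows "pd A P"
  unfolding pd_def
proof (intro conjI allI impI)
  show "symm_on A P" using assms by (auto simp: pd_def intro: symm_on_subset)
  fix x :: "'a \<Rightarrow> real" assume x: "\<exists>i\<in>A. x i \<noteq> 0"
  let ?x = "\<lambda>i. if i \<in> A then x i else 0"
  have "\<exists>i\<in>B. ?x i \<noteq> 0" using assms(3) x by force
  then have "0 < qf B P ?x" using assms(1) by (simp add: pd_def)
  also have "\<dots> = qf A P ?x" using assms by (intro qf_superset) auto
  also have "\<dots> = qf A P x" by (rule qf_cong) simp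
  finally show "0 < qf A P x" .
qed

lemma psd_schur:
  assumes "psd (insert i I) P" "finite I" "i \<notin> I" "P i i \<noteq> 0"
  shows "psd I (schur i P)"
  using assms qf_schur[of I i P] unfolding psd_def by (auto intro: symm_on_schur)

lemma pd_schur:
  assumes "pd (insert i I) P" "finite I" "i \<notin> I"
  shows "pd I (schur i P)"
  unfolding pd_def
proof (intro conjI allI impI)
  have Pi: "P i i \<noteq> 0" using pd_diag[OF assms(1)] assms(2) by fastforce
  have sym: "symm_on (insert i I) P" using assms by (simp add: pd_def)
  then show "symm_on I (schur i P)" by (rule symm_on_schur)
  fix x :: "'a \<Rightarrow> real" assume "\<exists>j\<in>I. x j \<noteq> 0"
  then obtain j where "j \<in> I" "x j \<noteq> 0" by auto
  then show "0 < qf I (schur i P) x"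
    unfolding qf_schur[OF assms(2,3) sym Pi] using assms unfolding pd_def
    by (metis fun_upd_other insertI2)
qed

text \<open>Along vectors with entry \<open>s\<close> at \<open>i\<close> and 1 at \<open>j\<close>
  the form is affine in \<open>s\<close>; a nonnegative affine function has slope zero.\<close>

lemma psd_zero_diag:
  assumes "psd I P" "finite I" "i \<in> I" "j \<in> I" "P i i = 0"
  shows "P i j = 0"
proof (cases "j = i")
  case False
  have "0 \<le> 2 * s * P i j + P j j" for s
  proof -
    let ?x = "\<lambda>l. if l = i then s else of_bool (l = j) :: real"
    have "0 \<le> qf I P ?x" using assms by (simp add: psd_def)
    also have "qf I P ?x = qf (insert i {j}) P ?x"
      using assms by (intro qf_superset) auto
    also have "\<dots> = P i i * (?x i)\<^sup>2 + 2 * ?x i * (\<Sum>l\<in>{j}. P i l * ?x l) + qf {j} P ?x"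
      using assms False
      by (intro qf_insert) (auto simp: psd_def intro: symm_on_subset)
    also have "\<dots> = 2 * s * P i j + P j j" using assms False by (simp add: qf_def)
    finally show ?thesis .
  qed
  \<comment> \<open>Unless \<open>P i j\<close> is zero, this \<open>s\<close> gives the affine
    function the value -1.\<close>
  from this[of "- (P j j + 1) / (2 * P i j)"] show ?thesis
    by (cases "P i j = 0") (auto simp: field_simps)
qed (use assms in simp)

section \<open>Monotonicity of determinants and Fischer's inequality\<close>

lemma Det_pos: "finite I \<Longrightarrow> pd I P \<Longrightarrow> 0 < Det I P"
proof (induction I arbitrary: P rule: finite_induct)
  case (insert i I)
  have "0 < P i i" using insert by (intro pd_diag[of "insert i I"]) auto
  moreover have "0 < Det I (schur i P)" using insert by (intro insert.IH pd_schur) auto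
  ultimately show ?case using insert by (simp add: Det_schur)
qed simp

text \<open>Schur complements are partial minima of the forms, so they inherit the comparison and
  the pivots can be compared one by one. A zero pivot of \<open>P\<close> kills its whole row, and
  then the determinant of \<open>P\<close> is 0.\<close>

lemma Det_mono_psd:
  assumes "finite I" "psd I P" "pd I Q" "\<And>x. qf I P x \<le> qf I Q x"
  shows "0 \<le> Det I P \<and> Det I P \<le> Det I Q"
  using assms
proof (induction I arbitrary: P Q rule: finite_induct)
  case (insert i I)
  have Q: "0 < Q i i" using insert.prems insert.hyps by (intro pd_diag[of "insert i I"]) auto
  have P: "0 \<le> P i i" using insert.prems insert.hyps by (intro psd_diag[of "insert i I"]) auto
  have PQ: "P i i \<le> Q i i"
    using insert.prems(3)[of "\<lambda>j. of_bool (j = i)"] insert.hyps by (simp add: qf_unit)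
  have DQ: "0 < Det (insert i I) Q" using insert by (intro Det_pos) auto
  show ?case
  proof (cases "P i i = 0")
    case True
    have "Det (insert i I) P = 0"
      using psd_zero_diag[OF insert.prems(1) _ _ _ True] insert.hyps
      by (intro Det_zero_row[of _ i]) auto
    then show ?thesis using DQ by simp
  next
    case False
    with P have P': "0 < P i i" by simp
    have symP: "symm_on (insert i I) P" and symQ: "symm_on (insert i I) Q"
      using insert.prems by (auto simp: psd_def pd_def)
    have "qf I (schur i P) x \<le> qf I (schur i Q) x" for x
    proof -
      \<comment> \<open>The minimiser for \<open>Q\<close>: at this point the form of
        \<open>P\<close> lies below that of \<open>Q\<close> and above its own minimum.\<close>
      let ?c = "- (\<Sum>j\<in>I. Q i j * x j) / Q i i"
      have "qf I (schur i P) x \<le> qf (insert i I) P (x(i := ?c))"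
        by (rule qf_schur_le[OF insert.hyps symP P'])
      also have "\<dots> \<le> qf (insert i I) Q (x(i := ?c))" by (rule insert.prems(3))
      also have "\<dots> = qf I (schur i Q) x"
        using Q by (simp add: qf_schur[OF insert.hyps symQ])
      finally show ?thesis .
    qed
    then have "0 \<le> Det I (schur i P) \<and> Det I (schur i P) \<le> Det I (schur i Q)"
      using insert False by (intro insert.IH psd_schur pd_schur) auto
    then show ?thesis
      using insert P' Q PQ by (auto simp: Det_schur intro!: mult_mono)
  qed
qed simp

text \<open>Eliminating an index of \<open>A\<close> splits off the same pivot on both sides. On
  \<open>B\<close> the elimination only lowers the form, so the determinant there is at most
  \<open>Det B P\<close> by monotonicity.\<close>

lemma Det_Fischer:
  assumes "finite A" "finite B" "A \<inter> B = {}" "pd (A \<union> B) P"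
  shows "Det (A \<union> B) P \<le> Det A P * Det B P"
  using assms
proof (induction A arbitrary: P rule: finite_induct)
  case (insert i A)
  have i: "i \<notin> A \<union> B" "finite (A \<union> B)" using insert by auto
  have pd: "pd (insert i (A \<union> B)) P" using insert by simp
  have Pi: "0 < P i i" using pd i by (intro pd_diag[of "insert i (A \<union> B)"]) auto
  have pds: "pd (A \<union> B) (schur i P)" using pd i by (intro pd_schur) auto
  have "Det (A \<union> B) (schur i P) \<le> Det A (schur i P) * Det B (schur i P)"
    using insert pds by (intro insert.IH) auto
  also have "\<dots> \<le> Det A (schur i P) * Det B P"
  proof (rule mult_left_mono)
    have "qf B (schur i P) x \<le> qf B P x" for x
      using Pi pd insert.prems
      by (subst qf_schur_diff) (auto simp: pd_def intro: symm_on_subset)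
    then show "Det B (schur i P) \<le> Det B P"
      using insert.prems i pd pds
      by (intro conjunct2[OF Det_mono_psd]) (auto intro: pd_imp_psd pd_subset)
    show "0 \<le> Det A (schur i P)"
      using pds i by (intro less_imp_le Det_pos) (auto intro: pd_subset)
  qed
  finally have "P i i * Det (A \<union> B) (schur i P) \<le> P i i * Det A (schur i P) * Det B P"
    using Pi by (simp add: mult.assoc)
  then show ?case using Pi i insert by (simp add: Det_schur)
qed simp

text \<open>Both sides obey the same elimination recursion; definiteness supplies its nonzero
  pivots.\<close>

lemma Det_image:
  assumes "finite I" "inj_on f I" "pd (f ` I) P"
  shows "Det (f ` I) P = Det I (\<lambda>i j. P (f i) (f j))"
  using assms
proof (induction I arbitrary: P rule: finite_induct)
  case (insert i I)
  have fi: "f i \<notin> f ` I" using insert by auto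
  have Pi: "0 < P (f i) (f i)" using insert by (intro pd_diag[of "f ` insert i I"]) auto
  have "Det (f ` I) (schur (f i) P) = Det I (\<lambda>j l. schur (f i) P (f j) (f l))"
    using insert fi by (intro insert.IH pd_schur) auto
  then show ?case using insert fi Pi by (simp add: Det_schur schur_def)
qed simp

section \<open>Gram matrices and Sylvester's identity\<close>

definition add_id :: "('a \<Rightarrow> 'a \<Rightarrow> real) \<Rightarrow> 'a \<Rightarrow> 'a \<Rightarrow> real" where
  "add_id P = (\<lambda>i j. of_bool (i = j) + P i j)"

text \<open>The matrix of the form \<open>M\<close> of the introduction: rows \<open>j\<close> of
  \<open>A\<close> serve as vectors, with weights \<open>w j\<close>.\<close>

definition gram :: "'r set \<Rightarrow> ('r \<Rightarrow> real) \<Rightarrow> ('r \<Rightarrow> 'c \<Rightarrow> real) \<Rightarrow> 'c \<Rightarrow> 'c \<Rightarrow> real" where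
  "gram J w A = (\<lambda>i l. \<Sum>j\<in>J. w j * A j i * A j l)"

lemma qf_add: "qf I (\<lambda>i j. P i j + Q i j) x = qf I P x + qf I Q x"
  by (simp add: qf_def algebra_simps sum.distrib)

lemma qf_scale: "qf I (\<lambda>i j. c * P i j) x = c * qf I P x"
  by (simp add: qf_def sum_distrib_left algebra_simps)

lemma qf_id: "finite I \<Longrightarrow> qf I (\<lambda>i j. of_bool (i = j)) x = (\<Sum>i\<in>I. (x i)\<^sup>2)"
  unfolding qf_def by (intro sum.cong refl) (simp add: power2_eq_square of_bool_def if_distrib if_distribR cong: if_cong)

lemma qf_add_id: "finite I \<Longrightarrow> qf I (add_id P) x = (\<Sum>i\<in>I. (x i)\<^sup>2) + qf I P x"
  by (simp add: add_id_def qf_add qf_id)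

lemma qf_gram: "qf I (gram J w A) x = (\<Sum>j\<in>J. w j * (\<Sum>i\<in>I. A j i * x i)\<^sup>2)"
proof -
  have "qf I (gram J w A) x = (\<Sum>i\<in>I. \<Sum>l\<in>I. \<Sum>j\<in>J. w j * ((A j i * x i) * (A j l * x l)))"
    unfolding qf_def gram_def by (simp add: sum_distrib_right sum_distrib_left algebra_simps)
  also have "\<dots> = (\<Sum>i\<in>I. \<Sum>j\<in>J. \<Sum>l\<in>I. w j * ((A j i * x i) * (A j l * x l)))"
    by (intro sum.cong refl sum.swap)
  also have "\<dots> = (\<Sum>j\<in>J. \<Sum>i\<in>I. \<Sum>l\<in>I. w j * ((A j i * x i) * (A j l * x l)))"
    by (rule sum.swap)
  also have "\<dots> = (\<Sum>j\<in>J. w j * (\<Sum>i\<in>I. A j i * x i)\<^sup>2)"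
    unfolding power2_eq_square sum_product by (simp only: sum_distrib_left)
  finally show ?thesis .
qed

lemma symm_on_gram: "symm_on I (gram J w A)"
  by (simp add: symm_on_def gram_def mult_ac)

lemma psd_gram: "(\<And>j. j \<in> J \<Longrightarrow> 0 \<le> w j) \<Longrightarrow> psd I (gram J w A)"
  unfolding psd_def qf_gram by (auto simp: symm_on_gram intro!: sum_nonneg)

lemma sum_squares_pos:
  fixes x :: "'a \<Rightarrow> real"
  assumes "finite I" "\<exists>i\<in>I. x i \<noteq> 0"
  shows "0 < (\<Sum>i\<in>I. (x i)\<^sup>2)"
  using assms by (auto intro: sum_pos2)

lemma symm_on_add_id:
  assumes "symm_on I P"
  shows "symm_on I (add_id P)"
  unfolding symm_on_def
proof (intro ballI)
  fix i j assume "i \<in> I" "j \<in> I"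
  then have "P i j = P j i" by (rule symm_onD[OF assms])
  then show "add_id P i j = add_id P j i" by (cases "i = j") (auto simp: add_id_def)
qed

lemma pd_add_id:
  assumes "finite I" "psd I P"
  shows "pd I (add_id P)"
  unfolding pd_def qf_add_id[OF assms(1)]
  using assms sum_squares_pos[OF assms(1)]
  by (auto simp: psd_def symm_on_add_id intro!: add_pos_nonneg)

text \<open>Every pivot is 1, and the zeros beside it keep the rest of the identity block and its
  border intact, so the successive Schur corrections simply add up.\<close>

lemma Det_eliminate_identity_block:
  assumes "finite A" "finite J" "A \<inter> J = {}" "\<And>i l. i \<in> A \<Longrightarrow> l \<in> A \<Longrightarrow> N i l = of_bool (i = l)"
  shows "Det (A \<union> J) N = Det J (\<lambda>j l. N j l - (\<Sum>i\<in>A. N j i * N i l))"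
  using assms
proof (induction A arbitrary: N rule: finite_induct)
  case (insert i A)
  have Ni: "N i i = 1" using insert.prems by simp
  have 0: "N i l = 0" "N l i = 0" if "l \<in> A" for l
    using insert.prems(3)[of i l] insert.prems(3)[of l i] that insert.hyps by (auto split: if_splits)
  have "Det (insert i A \<union> J) N = Det (A \<union> J) (schur i N)"
    using insert Ni by (simp add: Det_schur)
  also have "\<dots> = Det J (\<lambda>j l. schur i N j l - (\<Sum>a\<in>A. schur i N j a * schur i N a l))"
    using insert.prems Ni 0 by (intro insert.IH) (auto simp: schur_def)
  also have "\<dots> = Det J (\<lambda>j l. N j l - (\<Sum>i\<in>insert i A. N j i * N i l))"
    using insert.hyps by (simp add: schur_def Ni 0 algebra_simps)
  finally show ?case .
qed simp

lemma pd_image: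
  assumes "inj_on f I" "pd I (\<lambda>i j. P (f i) (f j))"
  shows "pd (f ` I) P"
  unfolding pd_def
proof (intro conjI allI impI)
  have "P (f i) (f j) = P (f j) (f i)" if "i \<in> I" "j \<in> I" for i j
    using assms(2) that unfolding pd_def by (auto dest: symm_onD)
  then show "symm_on (f ` I) P" unfolding symm_on_def by blast
  fix x :: "_ \<Rightarrow> real" assume "\<exists>i\<in>f ` I. x i \<noteq> 0"
  then obtain i where "i \<in> I" "x (f i) \<noteq> 0" by blast
  then have "0 < qf I (\<lambda>i j. P (f i) (f j)) (\<lambda>i. x (f i))"
    by (rule pdD[OF assms(2), where x = "\<lambda>i. x (f i)"])
  also have "\<dots> = qf (f ` I) P x"
    using assms(1) by (simp add: qf_def sum.reindex)
  finally show "0 < qf (f ` I) P x" .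
qed

text \<open>Both sides are obtained from the block matrix with rows \<open>(1, -V\<^sup>T)\<close> and \<open>(V, 1)\<close> by
  eliminating one of the two identity blocks.\<close>

lemma Det_Sylvester:
  fixes v :: "'b \<Rightarrow> 'a \<Rightarrow> real"
  assumes "finite I" "finite J"
  shows "Det I (add_id (\<lambda>i l. \<Sum>j\<in>J. v j i * v j l)) = Det J (add_id (\<lambda>j l. \<Sum>i\<in>I. v j i * v l i))"
proof -
  \<comment> \<open>The off-diagonal blocks have opposite signs, so the subtraction in either
    elimination becomes the addition of a Gram matrix to the identity.\<close>
  define N where "N = (\<lambda>a b. case (a, b) of
      (Inl i, Inl l) \<Rightarrow> of_bool (i = l)
    | (Inl i, Inr j) \<Rightarrow> - v j i
    | (Inr j, Inl i) \<Rightarrow> v j i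
    | (Inr j, Inr l) \<Rightarrow> of_bool (j = l))"
  define P where "P = add_id (\<lambda>i l. \<Sum>j\<in>J. v j i * v j l)"
  define Q where "Q = add_id (\<lambda>j l. \<Sum>i\<in>I. v j i * v l i)"
  have P: "psd I (\<lambda>i l. \<Sum>j\<in>J. v j i * v j l)"
    using psd_gram[of J "\<lambda>_. 1" I v] by (simp add: gram_def)
  have Q: "psd J (\<lambda>j l. \<Sum>i\<in>I. v j i * v l i)"
    using psd_gram[of I "\<lambda>_. 1" J "\<lambda>i j. v j i"] by (simp add: gram_def)
  \<comment> \<open>Copies of both sides on the sum type, where they can be compared with the
    eliminated forms of \<open>N\<close>.\<close>
  define P' where "P' = (\<lambda>(a :: 'a + 'b) (b :: 'a + 'b). P (projl a) (projl b))"
  define Q' where "Q' = (\<lambda>(a :: 'a + 'b) (b :: 'a + 'b). Q (projr a) (projr b))"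
  have pdP': "pd (Inl ` I) P'"
    using pd_add_id[OF assms(1) P] by (intro pd_image) (simp_all add: P'_def P_def)
  have pdQ': "pd (Inr ` J) Q'"
    using pd_add_id[OF assms(2) Q] by (intro pd_image) (simp_all add: Q'_def Q_def)
  have "Det I P = Det (Inl ` I) P'"
    using pdP' assms by (subst Det_image) (auto simp: P'_def)
  also have "\<dots> = Det (Inl ` I) (\<lambda>a b. N a b - (\<Sum>c\<in>Inr ` J. N a c * N c b))"
    by (rule Det_cong) (auto simp: N_def P'_def P_def add_id_def sum.reindex sum_negf)
  also have "\<dots> = Det (Inr ` J \<union> Inl ` I) N"
    using assms by (intro Det_eliminate_identity_block[symmetric]) (auto simp: N_def)
  also have "\<dots> = Det (Inl ` I \<union> Inr ` J) N"
    by (simp add: Un_commute)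
  also have "\<dots> = Det (Inr ` J) (\<lambda>a b. N a b - (\<Sum>c\<in>Inl ` I. N a c * N c b))"
    using assms by (intro Det_eliminate_identity_block) (auto simp: N_def)
  also have "\<dots> = Det (Inr ` J) Q'"
    by (rule Det_cong) (auto simp: N_def Q'_def Q_def add_id_def sum.reindex sum_negf)
  also have "\<dots> = Det J Q"
    using pdQ' assms by (subst Det_image) (auto simp: Q'_def)
  finally show ?thesis by (simp add: P_def Q_def)
qed

text \<open>Sylvester's identity moves the determinant from columns to rows. There the split of the
  row set is a split into diagonal blocks, to which Fischer's inequality applies.\<close>

lemma Det_add_id_gram_Un:
  assumes "finite I" "finite J" "finite K" "J \<inter> K = {}" "\<And>j. j \<in> J \<union> K \<Longrightarrow> 0 \<le> w j"
  shows "Det I (add_id (gram (J \<union> K) w A))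
       \<le> Det I (add_id (gram J w A)) * Det I (add_id (gram K w A))"
proof -
  define v where "v j i = sqrt (w j) * A j i" for j i
  define G where "G = add_id (\<lambda>j l. \<Sum>i\<in>I. v j i * v l i)"
  have eq: "Det I (add_id (gram L w A)) = Det L G" if "L \<subseteq> J \<union> K" for L
  proof -
    have "gram L w A = (\<lambda>i l. \<Sum>j\<in>L. v j i * v j l)"
      unfolding gram_def
    proof (intro ext sum.cong refl)
      fix i l j assume "j \<in> L"
      then have "sqrt (w j) * sqrt (w j) = w j" using that assms(5) by auto
      then have "w j * A j i * A j l = sqrt (w j) * sqrt (w j) * A j i * A j l" by (simp only:)
      then show "w j * A j i * A j l = v j i * v j l" by (simp only: v_def mult_ac)
    qed
    moreover have "finite L" using that assms finite_subset by blast
    ultimately show ?thesis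
      using Det_Sylvester[OF assms(1), of L v] by (simp only: G_def)
  qed
  have "psd (J \<union> K) (\<lambda>j l. \<Sum>i\<in>I. v j i * v l i)"
    using psd_gram[of I "\<lambda>_. 1" "J \<union> K" "\<lambda>i j. v j i"] by (simp add: gram_def)
  then have "pd (J \<union> K) G"
    unfolding G_def using assms by (intro pd_add_id) auto
  then show ?thesis
    using Det_Fischer[of J K G] assms by (simp add: eq)
qed

text \<open>Sylvester's identity with a single row leaves a one by one determinant.\<close>

lemma Det_add_id_rank_one:
  assumes "finite I"
  shows "Det I (add_id (\<lambda>i l. y i * y l)) = 1 + (\<Sum>i\<in>I. (y i)\<^sup>2)"
proof -
  have "Det {()} Q = Q () ()" for Q
    using Det_clear_column[of "{}" "()" Q] by simp
  then show ?thesis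
    using Det_Sylvester[OF assms, of "{()}" "\<lambda>_. y"] by (simp add: add_id_def power2_eq_square)
qed

section \<open>Small lattice points and principal minors\<close>

text \<open>From the least integer above \<open>- \<beta>\<close> on, the terms are dominated by a
  geometric series with ratio \<open>exp (- r)\<close>, and \<open>exp r \<ge> 1 + r\<close> bounds
  its sum.\<close>

lemma one_sided_exp_sum_le:
  fixes U :: "int set" and \<beta> r :: real
  assumes "finite U" "0 < r" "\<And>u. u \<in> U \<Longrightarrow> 0 \<le> real_of_int u + \<beta>"
  shows "(\<Sum>u\<in>U. exp (- r * (real_of_int u + \<beta>))) \<le> 1 + 1 / r"
proof -
  define c where "c = \<lceil>- \<beta>\<rceil>"
  define q where "q = exp (- r)"
  have q: "0 < q" "q < 1" using assms by (auto simp: q_def)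
  have c: "c \<le> u" if "u \<in> U" for u
    using assms(3)[OF that] unfolding c_def by (simp add: ceiling_le_iff)
  have inj: "inj_on (\<lambda>u. nat (u - c)) U"
  proof (rule inj_onI)
    fix u u' assume "u \<in> U" "u' \<in> U" "nat (u - c) = nat (u' - c)"
    then show "u = u'" using c[of u] c[of u'] by linarith
  qed
  have "(\<Sum>u\<in>U. exp (- r * (real_of_int u + \<beta>))) \<le> (\<Sum>u\<in>U. q ^ nat (u - c))"
  proof (rule sum_mono)
    fix u assume u: "u \<in> U"
    have "- \<beta> \<le> real_of_int c" unfolding c_def by (rule le_of_int_ceiling)
    then have "real (nat (u - c)) \<le> real_of_int u + \<beta>" using c[OF u] by simp
    then have "r * real (nat (u - c)) \<le> r * (real_of_int u + \<beta>)"
      using assms(2) by (intro mult_left_mono) auto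
    then show "exp (- r * (real_of_int u + \<beta>)) \<le> q ^ nat (u - c)"
      unfolding q_def by (subst exp_of_nat_mult[symmetric]) (simp add: algebra_simps)
  qed
  also have "\<dots> = (\<Sum>k\<in>(\<lambda>u. nat (u - c)) ` U. q ^ k)"
    using inj by (simp add: sum.reindex)
  also have "\<dots> \<le> (\<Sum>k. q ^ k)"
    using q assms(1) by (intro sum_le_suminf summable_geometric) auto
  also have "\<dots> = 1 / (1 - q)" using q by (simp add: suminf_geometric)
  also have "\<dots> \<le> 1 + 1 / r"
  proof -
    have "1 + r \<le> exp r" by (rule exp_ge_add_one_self)
    then have "q * (1 + r) \<le> q * exp r" using q by (intro mult_left_mono) auto
    also have "q * exp r = 1" by (simp add: q_def exp_minus)
    finally show ?thesis using assms(2) q by (simp add: field_simps)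
  qed
  finally show ?thesis .
qed

lemma exp_sum_le:
  fixes U :: "int set" and \<beta> r :: real
  assumes "finite U" "0 < r"
  shows "(\<Sum>u\<in>U. exp (- r * \<bar>real_of_int u + \<beta>\<bar>)) \<le> 2 * (1 + 1 / r)"
proof -
  define V where "V = {u \<in> U. 0 \<le> real_of_int u + \<beta>}"
  have fin: "finite V" "finite (U - V)" "V \<subseteq> U" using assms by (auto simp: V_def)
  have "(\<Sum>u\<in>V. exp (- r * \<bar>real_of_int u + \<beta>\<bar>)) = (\<Sum>u\<in>V. exp (- r * (real_of_int u + \<beta>)))"
    by (intro sum.cong) (auto simp: V_def)
  also have "\<dots> \<le> 1 + 1 / r"
    using fin assms by (intro one_sided_exp_sum_le) (auto simp: V_def)
  finally have 1: "(\<Sum>u\<in>V. exp (- r * \<bar>real_of_int u + \<beta>\<bar>)) \<le> 1 + 1 / r" .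
  have "(\<Sum>u\<in>U - V. exp (- r * \<bar>real_of_int u + \<beta>\<bar>))
      = (\<Sum>u\<in>U - V. exp (- r * (real_of_int (- u) + (- \<beta>))))"
    by (intro sum.cong) (auto simp: V_def)
  also have "\<dots> = (\<Sum>u\<in>uminus ` (U - V). exp (- r * (real_of_int u + (- \<beta>))))"
    by (simp add: sum.reindex)
  also have "\<dots> \<le> 1 + 1 / r"
    using fin assms by (intro one_sided_exp_sum_le) (auto simp: V_def)
  finally have 2: "(\<Sum>u\<in>U - V. exp (- r * \<bar>real_of_int u + \<beta>\<bar>)) \<le> 1 + 1 / r" .
  show ?thesis using 1 2 sum.subset_diff[OF fin(3) assms(1), of "\<lambda>u. exp (- r * \<bar>real_of_int u + \<beta>\<bar>)"]
    by simp
qed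

text \<open>From (z - 1/2)^2 >= 0 follows exp (-z^2) <= exp (1/4) exp (-z), which reduces the sum to
  an exponential one. The bound does not depend on the shift \<open>\<beta>\<close>, as the
  induction over coordinates requires.\<close>

lemma gaussian_sum_le:
  fixes U :: "int set" and \<beta> a :: real
  assumes "finite U" "0 < a"
  shows "(\<Sum>u\<in>U. exp (- a * (real_of_int u + \<beta>)\<^sup>2)) \<le> 3 * (1 + 1 / sqrt a)"
proof -
  have "(\<Sum>u\<in>U. exp (- a * (real_of_int u + \<beta>)\<^sup>2))
      \<le> (\<Sum>u\<in>U. exp (1/4) * exp (- sqrt a * \<bar>real_of_int u + \<beta>\<bar>))"
  proof (rule sum_mono)
    fix u
    define z where "z = sqrt a * \<bar>real_of_int u + \<beta>\<bar>"
    have "a * (real_of_int u + \<beta>)\<^sup>2 = z\<^sup>2" using assms by (simp add: z_def power_mult_distrib)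
    moreover have "0 \<le> (z - 1/2)\<^sup>2" by simp
    ultimately have "- a * (real_of_int u + \<beta>)\<^sup>2 \<le> 1/4 + - z" by (simp add: power2_eq_square algebra_simps)
    then show "exp (- a * (real_of_int u + \<beta>)\<^sup>2) \<le> exp (1/4) * exp (- sqrt a * \<bar>real_of_int u + \<beta>\<bar>)"
      unfolding exp_add[symmetric] z_def by simp
  qed
  also have "\<dots> \<le> (3/2) * (2 * (1 + 1 / sqrt a))"
    unfolding sum_distrib_left[symmetric]
  proof (rule mult_mono)
    show "exp (1/4) \<le> (3/2 :: real)"
      using exp_bound[of "1/4 :: real"] by (simp add: power2_eq_square)
    show "(\<Sum>u\<in>U. exp (- sqrt a * \<bar>real_of_int u + \<beta>\<bar>)) \<le> 2 * (1 + 1 / sqrt a)"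
      using assms by (intro exp_sum_le) auto
  qed (auto intro!: sum_nonneg)
  finally show ?thesis by simp
qed

lemma sum_PiE_insert:
  assumes "finite I" "i \<notin> I" "finite U"
  shows "(\<Sum>u\<in>PiE (insert i I) (\<lambda>_. U). f u) = (\<Sum>g\<in>PiE I (\<lambda>_. U). \<Sum>y\<in>U. f (g(i := y)))"
proof -
  have "(\<Sum>u\<in>PiE (insert i I) (\<lambda>_. U). f u)
      = (\<Sum>(y, g)\<in>U \<times> PiE I (\<lambda>_. U). f (g(i := y)))"
    unfolding PiE_insert_eq using inj_combinator[OF assms(2), of "\<lambda>_. U"]
    by (subst sum.reindex) (auto simp: case_prod_beta comp_def)
  also have "\<dots> = (\<Sum>y\<in>U. \<Sum>g\<in>PiE I (\<lambda>_. U). f (g(i := y)))"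
    by (rule sum.cartesian_product[symmetric])
  finally show ?thesis by (simp add: sum.swap[of _ U])
qed

text \<open>The \<open>a i\<close> are the pivots of Gaussian elimination. Completing the square
  turns the sum over one coordinate into a shifted one-dimensional sum whose bound ignores the
  shift. The pivots do not depend on \<open>\<tau>\<close> or \<open>U\<close>, so the scale can
  later tend to infinity.\<close>

lemma lattice_gaussian_sum_le:
  assumes "finite I" "pd I P"
  shows "\<exists>a. (\<forall>i\<in>I. 0 < a i) \<and> Det I P = (\<Prod>i\<in>I. a i) \<and>
    (\<forall>\<tau>>0. \<forall>U. finite U \<longrightarrow>
      (\<Sum>u\<in>PiE I (\<lambda>_. U). exp (- \<tau> * qf I P (\<lambda>i. real_of_int (u i))))
        \<le> (\<Prod>i\<in>I. 3 * (1 + 1 / sqrt (\<tau> * a i))))"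
  using assms
proof (induction I arbitrary: P rule: finite_induct)
  case (insert i I)
  have Pi: "0 < P i i" using insert by (intro pd_diag[of "insert i I"]) auto
  have sym: "symm_on (insert i I) P" using insert by (simp add: pd_def)
  obtain a where a: "\<forall>i\<in>I. 0 < a i" "Det I (schur i P) = (\<Prod>i\<in>I. a i)"
    and le: "\<forall>\<tau>>0. \<forall>U. finite U \<longrightarrow>
      (\<Sum>u\<in>PiE I (\<lambda>_. U). exp (- \<tau> * qf I (schur i P) (\<lambda>i. real_of_int (u i))))
        \<le> (\<Prod>i\<in>I. 3 * (1 + 1 / sqrt (\<tau> * a i)))"
    using insert.IH[OF pd_schur[OF insert.prems insert.hyps]] by blast
  define a' where "a' = a(i := P i i)"
  have prod: "(\<Prod>j\<in>insert i I. f (a' j)) = f (P i i) * (\<Prod>j\<in>I. f (a j))" for f :: "real \<Rightarrow> real"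
  proof -
    have "(\<Prod>j\<in>I. f (a' j)) = (\<Prod>j\<in>I. f (a j))"
      using insert.hyps by (intro prod.cong) (auto simp: a'_def)
    then show ?thesis using insert.hyps by (simp add: a'_def)
  qed
  show ?case
  proof (intro exI[of _ a'] conjI allI impI ballI)
    show "0 < a' j" if "j \<in> insert i I" for j using that a Pi by (auto simp: a'_def)
    show "Det (insert i I) P = (\<Prod>i\<in>insert i I. a' i)"
      using prod[of "\<lambda>x. x"] insert.hyps Pi a by (simp add: Det_schur)
    fix \<tau> :: real and U :: "int set" assume \<tau>: "0 < \<tau>" and U: "finite U"
    let ?L = "\<lambda>g. (\<Sum>j\<in>I. P i j * real_of_int (g j)) / P i i"
    have "(\<Sum>u\<in>PiE (insert i I) (\<lambda>_. U). exp (- \<tau> * qf (insert i I) P (\<lambda>i. real_of_int (u i))))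
        = (\<Sum>g\<in>PiE I (\<lambda>_. U). \<Sum>y\<in>U. exp (- (\<tau> * P i i) * (real_of_int y + ?L g)\<^sup>2) *
              exp (- \<tau> * qf I (schur i P) (\<lambda>i. real_of_int (g i))))"
      unfolding sum_PiE_insert[OF insert.hyps U]
    proof (intro sum.cong refl)
      fix g :: "'a \<Rightarrow> int" and y
      have 1: "(\<Sum>j\<in>I. P i j * real_of_int ((g(i := y)) j)) = (\<Sum>j\<in>I. P i j * real_of_int (g j))"
        using insert.hyps by (intro sum.cong) auto
      have 2: "qf I (schur i P) (\<lambda>j. real_of_int ((g(i := y)) j)) = qf I (schur i P) (\<lambda>j. real_of_int (g j))"
        using insert.hyps by (intro qf_cong) auto
      have "qf (insert i I) P (\<lambda>j. real_of_int ((g(i := y)) j))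
          = P i i * (real_of_int y + ?L g)\<^sup>2 + qf I (schur i P) (\<lambda>j. real_of_int (g j))"
        using qf_insert_schur[OF insert.hyps sym, of "\<lambda>j. real_of_int ((g(i := y)) j)"] Pi 1 2 by simp
      then show "exp (- \<tau> * qf (insert i I) P (\<lambda>j. real_of_int ((g(i := y)) j)))
          = exp (- (\<tau> * P i i) * (real_of_int y + ?L g)\<^sup>2) *
              exp (- \<tau> * qf I (schur i P) (\<lambda>i. real_of_int (g i)))"
        by (simp add: exp_add[symmetric] algebra_simps)
    qed
    also have "\<dots> \<le> (\<Sum>g\<in>PiE I (\<lambda>_. U). 3 * (1 + 1 / sqrt (\<tau> * P i i)) *
              exp (- \<tau> * qf I (schur i P) (\<lambda>i. real_of_int (g i))))"
      unfolding sum_distrib_right[symmetric] using Pi \<tau> U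
      by (intro sum_mono mult_right_mono gaussian_sum_le) auto
    also have "\<dots> \<le> 3 * (1 + 1 / sqrt (\<tau> * P i i)) * (\<Prod>i\<in>I. 3 * (1 + 1 / sqrt (\<tau> * a i)))"
      unfolding sum_distrib_left[symmetric] using Pi \<tau> le[rule_format, OF \<tau> U]
      by (intro mult_left_mono) auto
    also have "\<dots> = (\<Prod>j\<in>insert i I. 3 * (1 + 1 / sqrt (\<tau> * a' j)))"
      using prod[of "\<lambda>x. 3 * (1 + 1 / sqrt (\<tau> * x))"] by simp
    finally show "(\<Sum>u\<in>PiE (insert i I) (\<lambda>_. U). exp (- \<tau> * qf (insert i I) P (\<lambda>i. real_of_int (u i))))
        \<le> (\<Prod>j\<in>insert i I. 3 * (1 + 1 / sqrt (\<tau> * a' j)))" .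
  qed
qed auto

section \<open>Dyadic rounding and lattice points with small rows\<close>

text \<open>A bound on hereditary discrepancy stated through colourings; the signs are integers
  because they are added to integer points before halving.\<close>

definition herdisc_le :: "'r set \<Rightarrow> 'c set \<Rightarrow> ('r \<Rightarrow> 'c \<Rightarrow> real) \<Rightarrow> real \<Rightarrow> bool" where
  "herdisc_le J V A d \<longleftrightarrow> (\<forall>T\<subseteq>V. \<exists>\<chi> :: 'c \<Rightarrow> int. (\<forall>e\<in>T. \<chi> e \<in> {-1, 1}) \<and>
     (\<forall>j\<in>J. \<bar>\<Sum>e\<in>T. A j e * real_of_int (\<chi> e)\<bar> \<le> d))"

lemma herdisc_le_mono:
  "herdisc_le J V A d \<Longrightarrow> J' \<subseteq> J \<Longrightarrow> V' \<subseteq> V \<Longrightarrow> d \<le> d' \<Longrightarrow> herdisc_le J' V' A d'"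
  unfolding herdisc_le_def by (meson order_trans subsetD)

text \<open>The odd coordinates are coloured to make every coordinate even, at a cost of at most
  \<open>d\<close> per row, and the point is halved. The error obeys
  \<open>err (p + 1) = 2 * err p + d\<close>, whence the factor \<open>2 ^ p - 1\<close>.\<close>

lemma dyadic_rounding:
  assumes "finite S" "herdisc_le J S A d" "\<And>e. e \<in> S \<Longrightarrow> 0 \<le> y e \<and> y e \<le> 2 ^ p"
  shows "\<exists>x. (\<forall>e\<in>S. x e \<in> {0, 1}) \<and>
     (\<forall>j\<in>J. \<bar>\<Sum>e\<in>S. A j e * real_of_int (y e - 2 ^ p * x e)\<bar> \<le> (2 ^ p - 1) * d)"
  using assms(3)
proof (induction p arbitrary: y)
  case 0
  then have "\<forall>e\<in>S. y e \<in> {0, 1}" by force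
  then show ?case by (intro exI[of _ y]) simp
next
  case (Suc p)
  define T where "T = {e \<in> S. odd (y e)}"
  have T: "T \<subseteq> S" by (auto simp: T_def)
  obtain \<chi> :: "'a \<Rightarrow> int" where \<chi>: "\<forall>e\<in>T. \<chi> e \<in> {-1, 1}"
    "\<forall>j\<in>J. \<bar>\<Sum>e\<in>T. A j e * real_of_int (\<chi> e)\<bar> \<le> d"
    using assms(2)[unfolded herdisc_le_def, rule_format, of T] T by blast
  \<comment> \<open>The correction is 0 at even coordinates and odd at odd ones, so the division by
    2 below is exact.\<close>
  define c where "c e = (if e \<in> T then \<chi> e else 0)" for e
  define z where "z e = (y e + c e) div 2" for e
  have z: "2 * z e = y e + c e" if "e \<in> S" for e
  proof -
    have "even (y e + c e)" using that \<chi>(1) unfolding c_def T_def by fastforce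
    then show ?thesis unfolding z_def by simp
  qed
  have "0 \<le> z e \<and> z e \<le> 2 ^ p" if e: "e \<in> S" for e
  proof -
    have y: "0 \<le> y e" "y e \<le> 2 * 2 ^ p" using Suc.prems[OF e] by auto
    have "- 1 \<le> c e" "c e \<le> 1" using \<chi>(1) unfolding c_def by auto
    then show ?thesis using z[OF e] y by linarith
  qed
  from Suc.IH[of z, OF this] obtain x where x: "\<forall>e\<in>S. x e \<in> {0, 1}"
     "\<forall>j\<in>J. \<bar>\<Sum>e\<in>S. A j e * real_of_int (z e - 2 ^ p * x e)\<bar> \<le> (2 ^ p - 1) * d" by blast
  have "\<bar>\<Sum>e\<in>S. A j e * real_of_int (y e - 2 ^ Suc p * x e)\<bar> \<le> (2 ^ Suc p - 1) * d" if j: "j \<in> J" for j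
  proof -
    have "(\<Sum>e\<in>S. A j e * real_of_int (y e - 2 ^ Suc p * x e))
        = (\<Sum>e\<in>S. 2 * (A j e * real_of_int (z e - 2 ^ p * x e)) - A j e * real_of_int (c e))"
    proof (rule sum.cong[OF refl])
      fix e assume "e \<in> S"
      then have y: "y e = 2 * z e - c e" using z[of e] by linarith
      show "A j e * real_of_int (y e - 2 ^ Suc p * x e)
          = 2 * (A j e * real_of_int (z e - 2 ^ p * x e)) - A j e * real_of_int (c e)"
        unfolding y by (simp add: algebra_simps)
    qed
    also have "\<dots> = 2 * (\<Sum>e\<in>S. A j e * real_of_int (z e - 2 ^ p * x e)) - (\<Sum>e\<in>S. A j e * real_of_int (c e))"
      by (simp only: sum_subtractf sum_distrib_left)
    also have "(\<Sum>e\<in>S. A j e * real_of_int (c e)) = (\<Sum>e\<in>T. A j e * real_of_int (\<chi> e))"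
      using assms(1) by (intro sum.mono_neutral_cong_right) (auto simp: c_def T_def)
    finally have "\<bar>\<Sum>e\<in>S. A j e * real_of_int (y e - 2 ^ Suc p * x e)\<bar> \<le> 2 * ((2 ^ p - 1) * d) + d"
      using x(2)[rule_format, OF j] \<chi>(2)[rule_format, OF j] by linarith
    then show ?thesis by (simp add: algebra_simps)
  qed
  with x(1) show ?case by blast
qed

text \<open>A point \<open>y\<close> of the box is recovered from its rounding \<open>x\<close> and
  the difference \<open>y - N x\<close>. The difference is good and \<open>x\<close> has only
  \<open>2 ^ card S\<close> values, so many differences must occur.\<close>

lemma card_small_lattice_points:
  fixes p :: nat
  assumes "finite S" "herdisc_le J S A d" "0 \<le> d"
  defines "N \<equiv> 2 ^ p :: int"
  defines "Good \<equiv> {u \<in> PiE S (\<lambda>_. {- N..N}). \<forall>j\<in>J. \<bar>\<Sum>e\<in>S. A j e * real_of_int (u e)\<bar> \<le> d * real_of_int N}"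
  shows "real_of_int N ^ card S \<le> real (card Good) * 2 ^ card S"
proof -
  let ?Y = "PiE S (\<lambda>_. {0..<N})" and ?X = "PiE S (\<lambda>_. {0, 1 :: int})"
  have "\<forall>y\<in>?Y. \<exists>x. (\<forall>e\<in>S. x e \<in> {0, 1}) \<and>
     (\<forall>j\<in>J. \<bar>\<Sum>e\<in>S. A j e * real_of_int (y e - 2 ^ p * x e)\<bar> \<le> (2 ^ p - 1) * d)"
  proof
    fix y assume "y \<in> ?Y"
    then have "\<And>e. e \<in> S \<Longrightarrow> 0 \<le> y e \<and> y e \<le> 2 ^ p"
      unfolding N_def by (metis PiE_mem atLeastLessThan_iff less_imp_le)
    then show "\<exists>x. (\<forall>e\<in>S. x e \<in> {0, 1}) \<and>
     (\<forall>j\<in>J. \<bar>\<Sum>e\<in>S. A j e * real_of_int (y e - 2 ^ p * x e)\<bar> \<le> (2 ^ p - 1) * d)"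
      by (rule dyadic_rounding[OF assms(1,2)])
  qed
  from bchoice[OF this] obtain x where x0: "\<forall>y\<in>?Y. (\<forall>e\<in>S. x y e \<in> {0, 1}) \<and>
     (\<forall>j\<in>J. \<bar>\<Sum>e\<in>S. A j e * real_of_int (y e - 2 ^ p * x y e)\<bar> \<le> (2 ^ p - 1) * d)"
    by blast
  have x: "x y e \<in> {0, 1}" if "y \<in> ?Y" "e \<in> S" for y e
    using x0 that by blast
  have le: "\<bar>\<Sum>e\<in>S. A j e * real_of_int (y e - N * x y e)\<bar> \<le> (2 ^ p - 1) * d"
    if "y \<in> ?Y" "j \<in> J" for y j
    using x0 that unfolding N_def by blast
  define f where "f y = (restrict (\<lambda>e. y e - N * x y e) S, restrict (x y) S)" for y
  have N: "1 \<le> N" by (simp add: N_def)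
  have "inj_on f ?Y"
  proof (rule inj_onI)
    fix y z assume yz: "y \<in> ?Y" "z \<in> ?Y" "f y = f z"
    have "y e = z e" if "e \<in> S" for e
    proof -
      from yz(3) have "restrict (\<lambda>e. y e - N * x y e) S e = restrict (\<lambda>e. z e - N * x z e) S e"
        "restrict (x y) S e = restrict (x z) S e" by (simp_all add: f_def)
      then show ?thesis using that by simp
    qed
    then show "y = z" using yz(1,2) by (intro PiE_ext[of y S _ z]) auto
  qed
  moreover have "f ` ?Y \<subseteq> Good \<times> ?X"
  proof
    fix v assume "v \<in> f ` ?Y"
    then obtain y where y: "y \<in> ?Y" "v = f y" by auto
    have "y e - N * x y e \<in> {- N..N}" if "e \<in> S" for e
    proof -
      have "y e \<in> {0..<N}" using y(1) that by (rule PiE_mem)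
      then show ?thesis using x[OF y(1) that] by auto
    qed
    moreover have "\<bar>\<Sum>e\<in>S. A j e * real_of_int (restrict (\<lambda>e. y e - N * x y e) S e)\<bar> \<le> d * real_of_int N"
      if "j \<in> J" for j
    proof -
      have "\<bar>\<Sum>e\<in>S. A j e * real_of_int (restrict (\<lambda>e. y e - N * x y e) S e)\<bar>
          = \<bar>\<Sum>e\<in>S. A j e * real_of_int (y e - N * x y e)\<bar>"
        by (intro arg_cong[where f=abs] sum.cong) auto
      also have "\<dots> \<le> (2 ^ p - 1) * d" using le[OF y(1) that] .
      also have "\<dots> \<le> d * real_of_int N" using assms(3) by (simp add: N_def algebra_simps)
      finally show ?thesis .
    qed
    ultimately have "fst v \<in> Good" unfolding Good_def y(2) f_def by simp
    moreover have "snd v \<in> ?X" using x[OF y(1)] by (simp add: y(2) f_def)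
    ultimately show "v \<in> Good \<times> ?X" by (simp add: mem_Times_iff)
  qed
  moreover have "finite (Good \<times> ?X)"
    using assms(1) unfolding Good_def by (intro finite_cartesian_product finite_PiE) (auto intro: finite_subset[OF _ finite_PiE])
  ultimately have "card ?Y \<le> card (Good \<times> ?X)" by (metis card_inj_on_le)
  also have "card ?Y = nat N ^ card S" using assms(1) by (simp add: card_PiE)
  also have "card (Good \<times> ?X) = card Good * 2 ^ card S"
    using assms(1) by (simp add: card_cartesian_product card_PiE numeral_2_eq_2)
  finally have "real (nat N ^ card S) \<le> real (card Good * 2 ^ card S)" by (rule of_nat_mono)
  then show ?thesis using N by simp
qed

section \<open>Determinants for a single system\<close>

text \<open>At scale \<open>N = 2 ^ p\<close> there are at least \<open>(N / 2) ^ card S\<close>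
  good points, each contributing at least \<open>exp (- card S)\<close> to a Gaussian sum. The upper
  bound for that sum by the pivots then bounds their product, the determinant, from above.\<close>

lemma Det_gram_le:
  assumes "finite S" "finite J" "\<And>j. j \<in> J \<Longrightarrow> 0 \<le> w j" "herdisc_le J S A d" "0 \<le> d"
    and c: "(\<Sum>j\<in>J. w j) * d\<^sup>2 \<le> c" "0 < c"
  shows "Det S (gram J w A) \<le> (72 * exp 2 * c / card S) ^ card S"
proof (cases "S = {}")
  case False
  define s where "s = real (card S)"
  have s: "0 < s" using False assms(1) by (simp add: s_def card_gt_0_iff)
  \<comment> \<open>The multiple of the identity makes the form definite and at most doubles its values on the
    lattice points that are counted.\<close>
  define P where "P = (\<lambda>i l. (c / s) * of_bool (i = l) + gram J w A i l)"
  have qfP: "qf S P x = (c / s) * (\<Sum>i\<in>S. (x i)\<^sup>2) + qf S (gram J w A) x" for x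
    unfolding P_def by (simp only: qf_add qf_scale qf_id[OF assms(1)])
  have psd: "psd S (gram J w A)" using assms by (intro psd_gram) auto
  have pd: "pd S P"
    unfolding pd_def
  proof (intro conjI allI impI)
    show "symm_on S P"
      unfolding symm_on_def P_def gram_def by (simp add: eq_commute mult_ac)
    fix x :: "'a \<Rightarrow> real" assume "\<exists>i\<in>S. x i \<noteq> 0"
    then show "0 < qf S P x"
      unfolding qfP using sum_squares_pos[OF assms(1)] psd c s
      by (intro add_pos_nonneg mult_pos_pos) (auto simp: psd_def)
  qed
  obtain a where a: "\<forall>i\<in>S. 0 < a i" "Det S P = (\<Prod>i\<in>S. a i)"
    and le: "\<forall>\<tau>>0. \<forall>U. finite U \<longrightarrow>
      (\<Sum>u\<in>PiE S (\<lambda>_. U). exp (- \<tau> * qf S P (\<lambda>i. real_of_int (u i))))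
        \<le> (\<Prod>i\<in>S. 3 * (1 + 1 / sqrt (\<tau> * a i)))"
    using lattice_gaussian_sum_le[OF assms(1) pd] by blast
  \<comment> \<open>At a good point the form is at most \<open>2 * c * R\<^sup>2\<close>; this
    factor, divided by \<open>R\<^sup>2\<close>, makes the exponent there at most
    \<open>s\<close>.\<close>
  define \<mu> where "\<mu> = s / (2 * c)"
  have \<mu>: "0 < \<mu>" using s c by (simp add: \<mu>_def)
  \<comment> \<open>The term \<open>(1/2) ^ p\<close> is the additive 1 of the one-dimensional
    bounds after rescaling; it disappears in the limit.\<close>
  have bound: "1 \<le> (\<Prod>i\<in>S. 6 * exp 1 * ((1/2) ^ p + 1 / sqrt (\<mu> * a i)))" for p
  proof -
    define N where "N = (2 ^ p :: int)"
    define R where "R = (2 ^ p :: real)"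
    have R: "real_of_int N = R" "0 < R" by (simp_all add: N_def R_def)
    define Good where "Good = {u \<in> PiE S (\<lambda>_. {- N..N}).
      \<forall>j\<in>J. \<bar>\<Sum>e\<in>S. A j e * real_of_int (u e)\<bar> \<le> d * real_of_int N}"
    have card: "R ^ card S \<le> real (card Good) * 2 ^ card S"
      using card_small_lattice_points[OF assms(1,4,5), of p] unfolding Good_def N_def R_def by simp
    define \<tau> where "\<tau> = \<mu> / R\<^sup>2"
    have \<tau>: "0 < \<tau>" using \<mu> R by (simp add: \<tau>_def)
    have good: "exp (- s) \<le> exp (- \<tau> * qf S P (\<lambda>i. real_of_int (u i)))" if u: "u \<in> Good" for u
    proof -
      have "qf S (gram J w A) (\<lambda>i. real_of_int (u i)) \<le> (\<Sum>j\<in>J. w j * (d * R)\<^sup>2)"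
        unfolding qf_gram
      proof (intro sum_mono mult_left_mono)
        fix j assume j: "j \<in> J"
        have "\<bar>\<Sum>i\<in>S. A j i * real_of_int (u i)\<bar> \<le> d * R"
          using u j unfolding Good_def R by blast
        then show "(\<Sum>i\<in>S. A j i * real_of_int (u i))\<^sup>2 \<le> (d * R)\<^sup>2"
          by (metis abs_ge_zero power2_abs power_mono)
        show "0 \<le> w j" using assms(3) j .
      qed
      also have "\<dots> = (\<Sum>j\<in>J. w j) * d\<^sup>2 * R\<^sup>2"
        by (simp only: sum_distrib_right power_mult_distrib mult.assoc)
      also have "\<dots> \<le> c * R\<^sup>2" using c by (intro mult_right_mono) auto
      finally have 1: "qf S (gram J w A) (\<lambda>i. real_of_int (u i)) \<le> c * R\<^sup>2" .
      have "(\<Sum>i\<in>S. (real_of_int (u i))\<^sup>2) \<le> (\<Sum>i\<in>S. R\<^sup>2)"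
      proof (rule sum_mono)
        fix i assume "i \<in> S"
        then have "u i \<in> {- N..N}" using u unfolding Good_def by blast
        then have "\<bar>real_of_int (u i)\<bar> \<le> R" unfolding R(1)[symmetric] by (simp add: abs_le_iff)
        then show "(real_of_int (u i))\<^sup>2 \<le> R\<^sup>2" by (metis abs_ge_zero power2_abs power_mono)
      qed
      then have "(\<Sum>i\<in>S. (real_of_int (u i))\<^sup>2) \<le> s * R\<^sup>2" by (simp add: s_def)
      then have "(c / s) * (\<Sum>i\<in>S. (real_of_int (u i))\<^sup>2) \<le> (c / s) * (s * R\<^sup>2)"
        using c s by (intro mult_left_mono) auto
      with 1 have "qf S P (\<lambda>i. real_of_int (u i)) \<le> 2 * c * R\<^sup>2" unfolding qfP using s by simp
      then have "\<tau> * qf S P (\<lambda>i. real_of_int (u i)) \<le> \<tau> * (2 * c * R\<^sup>2)"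
        using \<tau> by (intro mult_left_mono) auto
      also have "\<dots> = s" using R c by (simp add: \<tau>_def \<mu>_def)
      finally show ?thesis by simp
    qed
    have fin: "finite (PiE S (\<lambda>_. {- N..N}))" using assms(1) by (intro finite_PiE) auto
    have "real (card Good) * exp (- s) = (\<Sum>u\<in>Good. exp (- s))" by simp
    also have "\<dots> \<le> (\<Sum>u\<in>Good. exp (- \<tau> * qf S P (\<lambda>i. real_of_int (u i))))"
      by (intro sum_mono good)
    also have "\<dots> \<le> (\<Sum>u\<in>PiE S (\<lambda>_. {- N..N}). exp (- \<tau> * qf S P (\<lambda>i. real_of_int (u i))))"
      using fin by (intro sum_mono2) (auto simp: Good_def)
    also have "\<dots> \<le> (\<Prod>i\<in>S. 3 * (1 + 1 / sqrt (\<tau> * a i)))"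
      using le[rule_format, OF \<tau>, of "{- N..N}"] by simp
    finally have *: "real (card Good) * exp (- s) \<le> (\<Prod>i\<in>S. 3 * (1 + 1 / sqrt (\<tau> * a i)))" .
    have "1 = (R ^ card S) / R ^ card S" using R by simp
    also have "\<dots> \<le> (real (card Good) * 2 ^ card S) / R ^ card S"
      using card R by (intro divide_right_mono) auto
    also have "\<dots> = (real (card Good) * exp (- s)) * ((2 * exp 1 / R) ^ card S)"
      using R by (simp add: s_def power_divide power_mult_distrib exp_minus exp_of_nat_mult[symmetric])
    also have "\<dots> \<le> (\<Prod>i\<in>S. 3 * (1 + 1 / sqrt (\<tau> * a i))) * ((2 * exp 1 / R) ^ card S)"
      using R * by (intro mult_right_mono) auto
    also have "\<dots> = (\<Prod>i\<in>S. 3 * (1 + 1 / sqrt (\<tau> * a i)) * (2 * exp 1 / R))"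
      by (simp only: prod.distrib prod_constant)
    also have "\<dots> = (\<Prod>i\<in>S. 6 * exp 1 * ((1/2) ^ p + 1 / sqrt (\<mu> * a i)))"
    proof (rule prod.cong[OF refl])
      fix i assume "i \<in> S"
      have sq: "sqrt (\<tau> * a i) = sqrt (\<mu> * a i) / R"
        using R by (simp add: \<tau>_def real_sqrt_divide)
      have pR: "(1/2) ^ p = 1 / R" by (simp add: R_def power_divide)
      show "3 * (1 + 1 / sqrt (\<tau> * a i)) * (2 * exp 1 / R)
          = 6 * exp 1 * ((1/2) ^ p + 1 / sqrt (\<mu> * a i))"
        unfolding sq pR using R(2) by (simp add: field_simps)
    qed
    finally show ?thesis .
  qed
  have lim: "(\<lambda>p. \<Prod>i\<in>S. 6 * exp 1 * ((1/2) ^ p + 1 / sqrt (\<mu> * a i)))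
      \<longlonglongrightarrow> (\<Prod>i\<in>S. 6 * exp 1 * (0 + 1 / sqrt (\<mu> * a i)))"
    by (intro tendsto_intros LIMSEQ_realpow_zero) auto
  have "1 \<le> (\<Prod>i\<in>S. 6 * exp 1 * (0 + 1 / sqrt (\<mu> * a i)))"
    by (rule LIMSEQ_le_const[OF lim]) (use bound in auto)
  \<comment> \<open>Squaring removes the roots of the pivots. The constant 72 is 6^2 from the
    factors times 2 from \<open>\<mu>\<close>.\<close>
  then have "1 \<le> (\<Prod>i\<in>S. 6 * exp 1 * (0 + 1 / sqrt (\<mu> * a i)))\<^sup>2"
    by (rule one_le_power)
  also have "\<dots> = (\<Prod>i\<in>S. (72 * exp 2 * c / s) / a i)"
    unfolding prod_power_distrib
  proof (rule prod.cong[OF refl])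
    fix i assume i: "i \<in> S"
    have "0 < \<mu> * a i" using a(1) i \<mu> by simp
    then have "(6 * exp 1 * (0 + 1 / sqrt (\<mu> * a i)))\<^sup>2 = 36 * exp 2 / (\<mu> * a i)"
      by (simp add: power_mult_distrib power_divide exp_double[symmetric])
    then show "(6 * exp 1 * (0 + 1 / sqrt (\<mu> * a i)))\<^sup>2 = (72 * exp 2 * c / s) / a i"
      using s c by (simp add: \<mu>_def field_simps)
  qed
  also have "\<dots> = (72 * exp 2 * c / s) ^ card S / Det S P"
    by (simp only: prod_dividef prod_constant power_divide a(2))
  finally have "Det S P \<le> (72 * exp 2 * c / s) ^ card S"
    using Det_pos[OF assms(1) pd] by (simp only: pos_le_divide_eq mult_1)
  moreover have "Det S (gram J w A) \<le> Det S P"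
  proof (intro conjunct2[OF Det_mono_psd[OF assms(1) psd pd]])
    show "qf S (gram J w A) x \<le> qf S P x" for x
      unfolding qfP using c s by (simp add: sum_nonneg)
  qed
  ultimately show ?thesis by (simp add: s_def)
qed simp

lemma sum_power2_le_power2_sum:
  fixes f :: "'a \<Rightarrow> real"
  assumes "finite S" "\<And>i. i \<in> S \<Longrightarrow> 0 \<le> f i"
  shows "(\<Sum>i\<in>S. (f i)\<^sup>2) \<le> (\<Sum>i\<in>S. f i)\<^sup>2"
  using assms
proof (induction S rule: finite_induct)
  case (insert i S)
  have "0 \<le> f i" "0 \<le> sum f S" using insert by (auto intro: sum_nonneg)
  then have "0 \<le> 2 * f i * sum f S" by simp
  moreover have "(\<Sum>i\<in>S. (f i)\<^sup>2) \<le> (\<Sum>i\<in>S. f i)\<^sup>2" using insert by auto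
  ultimately show ?case using insert by (simp add: power2_sum)
qed simp

text \<open>With k = \<open>card I\<close> and z the root of k b, the subsets of size s contribute
  at most (k b)^s / (s!)^2, the square of z^s / s!. The sum of these squares is at most the square
  of the exponential series.\<close>

lemma sum_Pow_card_le_exp:
  fixes b :: real
  assumes "finite I" "0 \<le> b"
  shows "(\<Sum>S\<in>Pow I. (b / card S) ^ card S) \<le> exp (2 * sqrt (card I * b))"
proof -
  define k where "k = card I"
  define z where "z = sqrt (real k * b)"
  have z: "0 \<le> z" "z\<^sup>2 = real k * b" using assms by (auto simp: z_def)
  have "(\<Sum>S\<in>Pow I. (b / card S) ^ card S)
      = (\<Sum>s\<le>k. \<Sum>S | S \<in> Pow I \<and> card S = s. (b / card S) ^ card S)"
    using assms by (intro sum.group[symmetric]) (auto simp: k_def card_mono)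
  also have "\<dots> = (\<Sum>s\<le>k. real (k choose s) * (b / s) ^ s)"
    using n_subsets[OF assms(1)] by (intro sum.cong refl) (simp add: k_def)
  also have "\<dots> \<le> (\<Sum>s\<le>k. (z ^ s / fact s)\<^sup>2)"
  proof (rule sum_mono)
    fix s
    have "real ((k choose s) * fact s) \<le> real (k ^ s)"
      using binomial_fact_pow[of k s] by (simp only: of_nat_le_iff)
    then have 1: "real (k choose s) \<le> real k ^ s / fact s"
      by (simp add: field_simps)
    have "(b / s) ^ s = b ^ s / real s ^ s" by (simp add: power_divide)
    also have "\<dots> \<le> b ^ s / fact s"
      using assms(2) fact_le_power[of s, where ?'a = real]
      by (intro divide_left_mono mult_pos_pos) (auto intro: order_less_le_trans[OF fact_gt_zero])
    finally have 2: "(b / s) ^ s \<le> b ^ s / fact s" .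
    have "real (k choose s) * (b / s) ^ s \<le> (real k ^ s / fact s) * (b ^ s / fact s)"
      using assms(2) by (intro mult_mono 1 2) auto
    also have "\<dots> = (real k * b) ^ s / (fact s)\<^sup>2"
      by (simp add: power_mult_distrib power2_eq_square)
    also have "\<dots> = (z ^ s / fact s)\<^sup>2"
      unfolding z(2)[symmetric] by (simp add: power_divide power_mult[symmetric] mult.commute)
    finally show "real (k choose s) * (b / s) ^ s \<le> (z ^ s / fact s)\<^sup>2" .
  qed
  also have "\<dots> \<le> (\<Sum>s\<le>k. z ^ s / fact s)\<^sup>2"
    using z by (intro sum_power2_le_power2_sum) auto
  also have "\<dots> \<le> (exp z)\<^sup>2"
  proof (rule power_mono)
    have "(\<Sum>s\<le>k. z ^ s / fact s) \<le> (\<Sum>s. z ^ s / fact s)"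
      using z summable_exp[of z] by (intro sum_le_suminf) (auto simp: field_simps)
    then show "(\<Sum>s\<le>k. z ^ s / fact s) \<le> exp z" by (simp add: exp_def divide_inverse mult.commute)
  qed (use z in \<open>auto intro!: sum_nonneg\<close>)
  also have "\<dots> = exp (2 * z)" by (simp add: exp_double)
  finally show ?thesis by (simp add: z_def k_def)
qed

text \<open>The determinant is the sum of the principal minors, and the hereditary bound
  \<open>d\<close> holds on every \<open>S \<subseteq> I\<close> with the same
  \<open>c\<close>.\<close>

lemma Det_add_id_gram_le:
  assumes "finite I" "finite J" "\<And>j. j \<in> J \<Longrightarrow> 0 \<le> w j" "herdisc_le J I A d" "0 \<le> d"
    and c: "(\<Sum>j\<in>J. w j) * d\<^sup>2 \<le> c" "0 < c"
  shows "Det I (add_id (gram J w A)) \<le> exp (2 * sqrt (card I * (72 * exp 2 * c)))"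
proof -
  have "Det I (add_id (gram J w A)) = (\<Sum>S\<in>Pow I. Det S (gram J w A))"
    unfolding add_id_def by (rule Det_add_identity[OF assms(1)])
  also have "\<dots> \<le> (\<Sum>S\<in>Pow I. (72 * exp 2 * c / card S) ^ card S)"
  proof (rule sum_mono)
    fix S assume "S \<in> Pow I"
    then have "S \<subseteq> I" "finite S" using assms(1) finite_subset by auto
    then show "Det S (gram J w A) \<le> (72 * exp 2 * c / card S) ^ card S"
      using assms by (intro Det_gram_le[where d = d]) (auto intro: herdisc_le_mono)
  qed
  also have "\<dots> \<le> exp (2 * sqrt (card I * (72 * exp 2 * c)))"
    using c by (intro sum_Pow_card_le_exp assms(1)) auto
  finally show ?thesis .
qed

section \<open>Directions in which the union is small\<close>

lemma Det_add_id_gram_nonneg: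
  assumes "finite I" "\<And>j. j \<in> J \<Longrightarrow> 0 \<le> w j"
  shows "0 \<le> Det I (add_id (gram J w A))"
  by (rule less_imp_le[OF Det_pos[OF assms(1) pd_add_id[OF assms(1) psd_gram[OF assms(2)]]]])

lemma Det_add_id_gram_empty: "finite I \<Longrightarrow> Det I (add_id (gram {} w A)) = 1"
  using Det_add_id_rank_one[of I "\<lambda>_. 0"] by (simp add: gram_def)

lemma Det_add_id_gram_UN:
  assumes "finite I" "finite K" "\<And>k. k \<in> K \<Longrightarrow> finite (J k)"
    and "\<And>k l. k \<in> K \<Longrightarrow> l \<in> K \<Longrightarrow> k \<noteq> l \<Longrightarrow> J k \<inter> J l = {}"
    and "\<And>k j. k \<in> K \<Longrightarrow> j \<in> J k \<Longrightarrow> 0 \<le> w j"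
  shows "Det I (add_id (gram (\<Union>k\<in>K. J k) w A)) \<le> (\<Prod>k\<in>K. Det I (add_id (gram (J k) w A)))"
  using assms(2-5)
proof (induction K rule: finite_induct)
  case empty
  show ?case using assms(1) by (simp add: Det_add_id_gram_empty)
next
  case (insert k K)
  have fin: "finite (J k)" "finite (\<Union>k\<in>K. J k)" using insert.hyps insert.prems(1) by auto
  have disj: "J k \<inter> (\<Union>k\<in>K. J k) = {}" using insert.hyps insert.prems(2) by fastforce
  have w: "0 \<le> w j" if "j \<in> J k \<union> (\<Union>k\<in>K. J k)" for j using insert.prems(3) that by auto
  have IH: "Det I (add_id (gram (\<Union>k\<in>K. J k) w A)) \<le> (\<Prod>k\<in>K. Det I (add_id (gram (J k) w A)))"
    using insert.prems by (intro insert.IH) (meson insertI2)+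
  have "Det I (add_id (gram (\<Union>k\<in>insert k K. J k) w A))
      \<le> Det I (add_id (gram (J k) w A)) * Det I (add_id (gram (\<Union>k\<in>K. J k) w A))"
    using Det_add_id_gram_Un[OF assms(1) fin disj w] by simp
  also have "\<dots> \<le> Det I (add_id (gram (J k) w A)) * (\<Prod>k\<in>K. Det I (add_id (gram (J k) w A)))"
    using w by (intro mult_left_mono IH Det_add_id_gram_nonneg assms(1)) auto
  finally show ?case using insert.hyps by simp
qed

text \<open>Cauchy--Schwarz, obtained by comparing each root with the root \<open>\<alpha>\<close>
  of the mean through the inequality of arithmetic and geometric means.\<close>

lemma sum_sqrt_le:
  fixes c :: "'a \<Rightarrow> real"
  assumes "finite K" "\<And>k. k \<in> K \<Longrightarrow> 0 \<le> c k"
  shows "(\<Sum>k\<in>K. sqrt (c k)) \<le> sqrt (card K * (\<Sum>k\<in>K. c k))"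
proof (cases "(\<Sum>k\<in>K. c k) = 0")
  case True
  then have "c k = 0" if "k \<in> K" for k using assms that by (simp add: sum_nonneg_eq_0_iff)
  then show ?thesis by simp
next
  case False
  define s where "s = (\<Sum>k\<in>K. c k)"
  have s: "0 < s" using False sum_nonneg[of K c, OF assms(2)] unfolding s_def by linarith
  have t: "0 < card K" using False assms(1) by (auto simp: card_gt_0_iff)
  define \<alpha> where "\<alpha> = sqrt (s / card K)"
  have \<alpha>: "0 < \<alpha>" "\<alpha>\<^sup>2 = s / card K" using s t by (auto simp: \<alpha>_def)
  have "(\<Sum>k\<in>K. sqrt (c k)) \<le> (\<Sum>k\<in>K. (c k / \<alpha> + \<alpha>) / 2)"
  proof (rule sum_mono)
    fix k assume "k \<in> K"
    then have "c k = (sqrt (c k))\<^sup>2" using assms(2) by simp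
    moreover have "0 \<le> (sqrt (c k) - \<alpha>)\<^sup>2" by simp
    ultimately have "2 * \<alpha> * sqrt (c k) \<le> c k + \<alpha>\<^sup>2" by (simp add: power2_diff mult_ac)
    then show "sqrt (c k) \<le> (c k / \<alpha> + \<alpha>) / 2" using \<alpha>(1) by (simp add: field_simps power2_eq_square)
  qed
  also have "\<dots> = (s / \<alpha> + card K * \<alpha>) / 2"
    by (simp add: s_def sum.distrib sum_divide_distrib[symmetric])
  also have "s = card K * \<alpha>\<^sup>2" using \<alpha> t by simp
  also have "(card K * \<alpha>\<^sup>2 / \<alpha> + card K * \<alpha>) / 2 = card K * \<alpha>"
    using \<alpha>(1) by (simp add: power2_eq_square)
  also have "\<dots> = sqrt ((card K * \<alpha>)\<^sup>2)" using \<alpha>(1) by simp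
  also have "(card K * \<alpha>)\<^sup>2 = card K * s"
    using t by (simp add: power_mult_distrib \<alpha>(2)) (simp add: power2_eq_square)
  finally show ?thesis by (simp add: s_def)
qed

text \<open>The determinants multiply, so the exponents add, and Cauchy--Schwarz bounds their sum.
  The padded weights sum to \<open>2 * W\<close>, which turns 72 into 144.\<close>

lemma Det_add_id_gram_UN_le:
  assumes "finite I" "finite K" "\<And>k. k \<in> K \<Longrightarrow> finite (J k)"
    and disj: "\<And>k l. k \<in> K \<Longrightarrow> l \<in> K \<Longrightarrow> k \<noteq> l \<Longrightarrow> J k \<inter> J l = {}"
    and w: "\<And>k j. k \<in> K \<Longrightarrow> j \<in> J k \<Longrightarrow> 0 \<le> w j"
    and hd: "\<And>k. k \<in> K \<Longrightarrow> herdisc_le (J k) I A d" and "0 < d"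
    and W: "W = (\<Sum>j\<in>(\<Union>k\<in>K. J k). w j)" "0 < W"
  shows "Det I (add_id (gram (\<Union>k\<in>K. J k) w A))
      \<le> exp (2 * sqrt (144 * exp 2 * card I * card K * d\<^sup>2 * W))"
proof -
  have K: "0 < card K" using W assms(2) by (auto simp: card_gt_0_iff)
  \<comment> \<open>The summand \<open>W / card K\<close> only serves to make \<open>c k\<close> positive.\<close>
  define c where "c k = ((\<Sum>j\<in>J k. w j) + W / card K) * d\<^sup>2" for k
  have Wk: "0 \<le> (\<Sum>j\<in>J k. w j)" if "k \<in> K" for k using w that by (intro sum_nonneg) auto
  have c: "0 < c k" if "k \<in> K" for k
    using Wk[OF that] W(2) K \<open>0 < d\<close> unfolding c_def by (intro mult_pos_pos add_nonneg_pos) auto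
  have "W = (\<Sum>k\<in>K. \<Sum>j\<in>J k. w j)"
    unfolding W(1) using assms(2,3) disj by (intro sum.UNION_disjoint) auto
  then have sumc: "(\<Sum>k\<in>K. c k) = 2 * W * d\<^sup>2"
    using K unfolding c_def by (simp add: sum_distrib_right[symmetric] sum.distrib)
  have "Det I (add_id (gram (\<Union>k\<in>K. J k) w A)) \<le> (\<Prod>k\<in>K. Det I (add_id (gram (J k) w A)))"
    using assms by (intro Det_add_id_gram_UN) auto
  also have "\<dots> \<le> (\<Prod>k\<in>K. exp (2 * sqrt (card I * (72 * exp 2 * c k))))"
  proof (rule prod_mono, intro conjI)
    fix k assume k: "k \<in> K"
    show "0 \<le> Det I (add_id (gram (J k) w A))"
      using w k by (intro Det_add_id_gram_nonneg assms(1)) auto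
    show "Det I (add_id (gram (J k) w A)) \<le> exp (2 * sqrt (card I * (72 * exp 2 * c k)))"
    proof (rule Det_add_id_gram_le[where d = d])
      show "(\<Sum>j\<in>J k. w j) * d\<^sup>2 \<le> c k"
        using W(2) K unfolding c_def by (intro mult_right_mono) auto
    qed (use assms k c in auto)
  qed
  also have "\<dots> = exp (2 * (\<Sum>k\<in>K. sqrt (card I * (72 * exp 2 * c k))))"
    using assms(2) by (simp add: exp_sum[symmetric] sum_distrib_left)
  also have "\<dots> \<le> exp (2 * sqrt (card K * (\<Sum>k\<in>K. card I * (72 * exp 2 * c k))))"
  proof -
    have "(\<Sum>k\<in>K. sqrt (card I * (72 * exp 2 * c k))) \<le> sqrt (card K * (\<Sum>k\<in>K. card I * (72 * exp 2 * c k)))"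
      using c by (intro sum_sqrt_le assms(2)) (simp add: less_imp_le)
    then show ?thesis by simp
  qed
  also have "(\<Sum>k\<in>K. card I * (72 * exp 2 * c k)) = card I * (72 * exp 2 * (2 * W * d\<^sup>2))"
    unfolding sumc[symmetric] by (simp only: sum_distrib_left)
  also have "card K * (card I * (72 * exp 2 * (2 * W * d\<^sup>2))) = 144 * exp 2 * card I * card K * d\<^sup>2 * W"
    by (simp add: mult_ac)
  finally show ?thesis .
qed

section \<open>Lower bounds from largeness on a hyperplane\<close>

lemma qf_rank_one: "qf I (\<lambda>i l. y i * y l) x = (\<Sum>i\<in>I. x i * y i)\<^sup>2"
  unfolding qf_def power2_eq_square sum_product by (intro sum.cong refl) (simp add: mult_ac)

text \<open>The parallelogram law with one nonnegative term dropped.\<close>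

lemma psd_sub_le:
  assumes "psd I P"
  shows "qf I P (\<lambda>i. x i - y i) \<le> 2 * qf I P x + 2 * qf I P y"
proof -
  have "qf I P (\<lambda>i. x i - y i) + qf I P (\<lambda>i. x i + y i) = 2 * qf I P x + 2 * qf I P y"
    unfolding qf_def
    by (simp add: sum_distrib_left sum.distrib[symmetric]) (simp add: algebra_simps)
  moreover have "0 \<le> qf I P (\<lambda>i. x i + y i)" using assms by (simp add: psd_def)
  ultimately show ?thesis by linarith
qed

text \<open>The rank-one term is one further row \<open>y\<close> of weight \<open>c\<close>,
  indexed by \<open>None\<close>, so the bound for a union of row sets applies.\<close>

lemma Det_add_id_gram_rank_one_le:
  assumes "finite I" "finite J" "\<And>j. j \<in> J \<Longrightarrow> 0 \<le> w j" "0 \<le> c"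
  shows "Det I (add_id (\<lambda>i l. gram J w A i l + c * (y i * y l)))
       \<le> Det I (add_id (gram J w A)) * (1 + c * (\<Sum>i\<in>I. (y i)\<^sup>2))"
proof -
  define w' where "w' = case_option c w"
  define A' where "A' = case_option y A"
  have 1: "gram (Some ` J) w' A' = gram J w A"
    by (simp add: gram_def w'_def A'_def sum.reindex)
  have 2: "gram (Some ` J \<union> {None}) w' A' = (\<lambda>i l. gram J w A i l + c * (y i * y l))"
    unfolding 1[symmetric] unfolding gram_def using assms(2)
    by (intro ext) (simp add: w'_def A'_def mult_ac)
  have 3: "Det I (add_id (gram {None} w' A')) = 1 + c * (\<Sum>i\<in>I. (y i)\<^sup>2)"
  proof -
    have "gram {None} w' A' = (\<lambda>i l. (sqrt c * y i) * (sqrt c * y l))"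
      using assms(4) by (intro ext) (simp add: gram_def w'_def A'_def)
    then show ?thesis
      using assms(1,4) by (simp add: Det_add_id_rank_one power_mult_distrib sum_distrib_left)
  qed
  have "Det I (add_id (gram (Some ` J \<union> {None}) w' A'))
      \<le> Det I (add_id (gram (Some ` J) w' A')) * Det I (add_id (gram {None} w' A'))"
    using assms by (intro Det_add_id_gram_Un) (auto simp: w'_def)
  then show ?thesis unfolding 1 2 3 .
qed

text \<open>Compare \<open>1 + M + K y y\<^sup>T\<close> with \<open>3/2 + (K - L) y y\<^sup>T\<close> for large \<open>K\<close>: the factor contributed by
  the direction \<open>y\<close> cancels up to a constant.\<close>

lemma Det_add_id_ge_of_hyperplane:
  assumes "finite I" "finite J" "\<And>j. j \<in> J \<Longrightarrow> 0 \<le> w j" "0 < (\<Sum>i\<in>I. (y i)\<^sup>2)"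
    and ge: "\<And>x. (\<Sum>i\<in>I. x i * y i) = 0 \<Longrightarrow> (\<Sum>i\<in>I. (x i)\<^sup>2) \<le> qf I (gram J w A) x"
  shows "(3/2) ^ card I / 2 \<le> Det I (add_id (gram J w A))"
proof -
  define M where "M = gram J w A"
  have psd: "psd I M" unfolding M_def using assms by (intro psd_gram) auto
  define Y where "Y = (\<Sum>i\<in>I. (y i)\<^sup>2)"
  have Y: "0 < Y" using assms by (simp add: Y_def)
  \<comment> \<open>Write \<open>x = z + s y\<close> with \<open>z\<close> orthogonal to
    \<open>y\<close>. Then \<open>L * (s * Y)\<^sup>2\<close> pays exactly for
    \<open>s\<^sup>2 * Y / 2\<close> in half the norm of \<open>x\<close> and for the loss
    \<open>s\<^sup>2 * qf I M y\<close> in the parallelogram law.\<close>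
  define L where "L = (Y / 2 + qf I M y) / Y\<^sup>2"
  have L: "0 \<le> L" using psd Y by (simp add: L_def psd_def)
  have lower: "3/2 * (\<Sum>i\<in>I. (x i)\<^sup>2) - L * (\<Sum>i\<in>I. x i * y i)\<^sup>2 \<le> (\<Sum>i\<in>I. (x i)\<^sup>2) + qf I M x" for x
  proof -
    define s where "s = (\<Sum>i\<in>I. x i * y i) / Y"
    define z where "z = (\<lambda>i. x i - s * y i)"
    have sY: "(\<Sum>i\<in>I. x i * y i) = s * Y" using Y by (simp add: s_def)
    have "(\<Sum>i\<in>I. z i * y i) = (\<Sum>i\<in>I. x i * y i - s * (y i)\<^sup>2)"
      by (intro sum.cong refl) (simp add: z_def power2_eq_square algebra_simps)
    also have "\<dots> = (\<Sum>i\<in>I. x i * y i) - s * Y"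
      by (simp only: Y_def sum_subtractf sum_distrib_left)
    finally have "(\<Sum>i\<in>I. z i * y i) = (\<Sum>i\<in>I. x i * y i) - s * Y" .
    then have z0: "(\<Sum>i\<in>I. z i * y i) = 0" using sY by simp
    have "(\<Sum>i\<in>I. (z i)\<^sup>2) = (\<Sum>i\<in>I. (x i)\<^sup>2 - 2 * s * (x i * y i) + s\<^sup>2 * (y i)\<^sup>2)"
      by (intro sum.cong refl) (simp add: z_def power2_eq_square algebra_simps)
    also have "\<dots> = (\<Sum>i\<in>I. (x i)\<^sup>2) - 2 * s * (\<Sum>i\<in>I. x i * y i) + s\<^sup>2 * Y"
      by (simp only: Y_def sum.distrib sum_subtractf sum_distrib_left)
    finally have zz: "(\<Sum>i\<in>I. (z i)\<^sup>2) = (\<Sum>i\<in>I. (x i)\<^sup>2) - s\<^sup>2 * Y"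
      unfolding sY by (simp add: power2_eq_square)
    have "qf I M (\<lambda>i. s * y i) = s\<^sup>2 * qf I M y"
      by (simp add: qf_def sum_distrib_left power2_eq_square mult_ac)
    then have "qf I M z \<le> 2 * qf I M x + 2 * (s\<^sup>2 * qf I M y)"
      using psd_sub_le[OF psd, of x "\<lambda>i. s * y i"] by (simp add: z_def)
    moreover have "(\<Sum>i\<in>I. (z i)\<^sup>2) \<le> qf I M z" using ge[OF z0] by (simp add: M_def)
    moreover have "L * (\<Sum>i\<in>I. x i * y i)\<^sup>2 = s\<^sup>2 * Y / 2 + s\<^sup>2 * qf I M y"
      using Y unfolding sY L_def by (simp add: field_simps power2_eq_square)
    ultimately show ?thesis using zz by linarith
  qed
  \<comment> \<open>With this value \<open>c\<close> equals \<open>K / 2\<close>, so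
    \<open>1 + c * Y\<close> is at least half of \<open>1 + K * Y\<close>; this is the 1/2 in the
    conclusion.\<close>
  define K where "K = 4 * L"
  define c where "c = 2/3 * (K - L)"
  have c3: "3/2 * c = K - L" by (simp add: c_def)
  have c: "0 \<le> c" "K / 2 \<le> c" using L by (simp_all add: c_def K_def)
  define B where "B = (\<lambda>i l. 3/2 * add_id (\<lambda>i l. c * (y i * y l)) i l)"
  have rank1: "psd I (\<lambda>i l. c * (y i * y l))"
    using psd_gram[of "{()}" "\<lambda>_. c" I "\<lambda>_. y"] c by (simp add: gram_def mult_ac)
  have qfB: "qf I B x = 3/2 * (\<Sum>i\<in>I. (x i)\<^sup>2) + 3/2 * c * (\<Sum>i\<in>I. x i * y i)\<^sup>2" for x
    unfolding B_def qf_scale qf_add_id[OF assms(1)] qf_rank_one by (simp add: algebra_simps)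
  have "psd I B"
    using pd_imp_psd[OF pd_add_id[OF assms(1) rank1]]
    unfolding psd_def B_def qf_scale by (simp add: symm_on_def)
  moreover have "psd I (\<lambda>i l. M i l + K * (y i * y l))"
    unfolding psd_def qf_add qf_scale qf_rank_one
    using psd L symm_on_gram[of I J w A] by (auto simp: psd_def K_def M_def symm_on_def mult.commute)
  then have "pd I (add_id (\<lambda>i l. M i l + K * (y i * y l)))"
    using assms(1) by (intro pd_add_id)
  moreover have "qf I B x \<le> qf I (add_id (\<lambda>i l. M i l + K * (y i * y l))) x" for x
    unfolding qfB qf_add_id[OF assms(1)] qf_add qf_scale qf_rank_one c3 left_diff_distrib
    using lower[of x] by linarith
  ultimately have "Det I B \<le> Det I (add_id (\<lambda>i l. M i l + K * (y i * y l)))"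
    using Det_mono_psd[OF assms(1)] by blast
  also have "\<dots> \<le> Det I (add_id M) * (1 + K * Y)"
    unfolding M_def Y_def using assms L by (intro Det_add_id_gram_rank_one_le) (auto simp: K_def)
  finally have upper: "Det I B \<le> Det I (add_id M) * (1 + K * Y)" .
  have DetB: "Det I B = (3/2) ^ card I * (1 + c * Y)"
  proof -
    have "(\<lambda>i l. c * (y i * y l)) = (\<lambda>i l. (sqrt c * y i) * (sqrt c * y l))"
      using c by (intro ext) simp
    then show ?thesis
      unfolding B_def Det_scale[OF assms(1)] Y_def using c
      by (simp add: Det_add_id_rank_one[OF assms(1)] power_mult_distrib sum_distrib_left)
  qed
  have "(1 + K * Y) / 2 \<le> 1 + c * Y"
  proof -
    have "K / 2 * Y \<le> c * Y" using c Y by (intro mult_right_mono) auto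
    then show ?thesis by (simp add: field_simps)
  qed
  then have "(3/2) ^ card I * ((1 + K * Y) / 2) \<le> (3/2) ^ card I * (1 + c * Y)"
    by (intro mult_left_mono) auto
  then have "(3/2) ^ card I / 2 * (1 + K * Y) \<le> Det I (add_id M) * (1 + K * Y)"
    using upper unfolding DetB times_divide_eq_left times_divide_eq_right by (rule order_trans)
  moreover have "0 < 1 + K * Y" using L Y by (simp add: K_def add_pos_nonneg)
  ultimately show ?thesis unfolding M_def by (rule mult_right_le_imp_le)
qed

text \<open>The rate 1/20 is small enough for the case of exponent 2, where 2 exp (1/10) has to stay
  below 9/4.\<close>

lemma exp_le_three_halves_power:
  assumes "2 \<le> k"
  shows "2 * exp (real k / 20) \<le> (3/2) ^ k"
  using assms
proof (induction k rule: dec_induct)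
  case base
  have "exp (1/10) \<le> (1 + 1/10 + (1/10)\<^sup>2 :: real)" by (rule exp_bound) auto
  then show ?case by (simp add: power2_eq_square)
next
  case (step k)
  have "exp (1/20) \<le> (1 + 1/20 + (1/20)\<^sup>2 :: real)" by (rule exp_bound) auto
  then have "exp (1/20) \<le> (3/2 :: real)" by (simp add: power2_eq_square)
  then have "exp (1/20) * (2 * exp (real k / 20)) \<le> 3/2 * (3/2) ^ k"
    using step by (intro mult_mono) auto
  moreover have "2 * exp (real (Suc k) / 20) = exp (1/20) * (2 * exp (real k / 20))"
    by (simp add: exp_add[symmetric] add_divide_distrib)
  ultimately show ?case by simp
qed

text \<open>Otherwise the form divided by \<open>\<mu>\<close> dominates the squared norm on a
  hyperplane. Its determinant is then at least \<open>(3/2) ^ card I / 2\<close>, more than the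
  upper bound for the union allows.\<close>

lemma small_direction:
  assumes "finite I" "2 \<le> card I" "finite K" "\<And>k. k \<in> K \<Longrightarrow> finite (G k)"
    and F: "F = (\<Union>k\<in>K. G k)" and w: "\<And>j. j \<in> F \<Longrightarrow> 0 \<le> w j" and W: "W = (\<Sum>j\<in>F. w j)" "0 < W"
    and hd: "\<And>k. k \<in> K \<Longrightarrow> herdisc_le (G k) I A d" and d: "0 < d"
  shows "\<exists>x. (\<Sum>i\<in>I. x i * y i) = 0 \<and> 0 < (\<Sum>i\<in>I. (x i)\<^sup>2) \<and>
    qf I (gram F w A) x \<le> 1440000 * exp 2 * card K * d\<^sup>2 * W / card I * (\<Sum>i\<in>I. (x i)\<^sup>2)"
proof (rule ccontr)
  assume contra: "\<not> ?thesis"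
  have finF: "finite F" using assms by auto
  have K: "0 < card K" using W assms(3) F by (auto simp: card_gt_0_iff)
  have I: "0 < card I" using assms(2) by linarith
  \<comment> \<open>As 1440000 is 144 times 100^2, the upper bound becomes
    \<open>exp (card I / 50)\<close>, below the rate 1/20 of the lower bound.\<close>
  define \<mu> where "\<mu> = 1440000 * exp 2 * card K * d\<^sup>2 * W / card I"
  have \<mu>: "0 < \<mu>" unfolding \<mu>_def using K I d W by simp
  define v where "v j = w j / \<mu>" for j
  have v: "0 \<le> v j" if "j \<in> F" for j using w[OF that] \<mu> by (simp add: v_def)
  have gram_v: "qf I (gram F v A) x = qf I (gram F w A) x / \<mu>" for x
    unfolding qf_gram v_def by (simp add: sum_divide_distrib)
  \<comment> \<open>If \<open>y\<close> vanishes on \<open>I\<close>, orthogonality to it is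
    automatic and any nonzero normal vector will do.\<close>
  define z where "z = (if 0 < (\<Sum>i\<in>I. (y i)\<^sup>2) then y else (\<lambda>_. 1))"
  have z: "0 < (\<Sum>i\<in>I. (z i)\<^sup>2)" using I by (simp add: z_def)
  have "(\<Sum>i\<in>I. (x i)\<^sup>2) \<le> qf I (gram F v A) x" if x: "(\<Sum>i\<in>I. x i * z i) = 0" for x
  proof (cases "0 < (\<Sum>i\<in>I. (x i)\<^sup>2)")
    case True
    have "(\<Sum>i\<in>I. x i * y i) = 0"
    proof (cases "0 < (\<Sum>i\<in>I. (y i)\<^sup>2)")
      case False
      then have "\<forall>i\<in>I. y i = 0" using sum_squares_pos[OF assms(1)] by blast
      then show ?thesis by simp
    qed (use x in \<open>simp add: z_def\<close>)
    then have "\<mu> * (\<Sum>i\<in>I. (x i)\<^sup>2) \<le> qf I (gram F w A) x"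
      using contra True unfolding \<mu>_def by force
    then show ?thesis unfolding gram_v using \<mu> by (simp add: field_simps)
  next
    case False
    moreover have "0 \<le> qf I (gram F v A) x" using psd_gram[of F v I A] v by (simp add: psd_def)
    ultimately show ?thesis by linarith
  qed
  then have "(3/2) ^ card I / 2 \<le> Det I (add_id (gram F v A))"
    using v z by (intro Det_add_id_ge_of_hyperplane[OF assms(1) finF]) auto
  also have "\<dots> \<le> exp (2 * sqrt (144 * exp 2 * card I * card K * d\<^sup>2 * (W / \<mu>)))"
  proof -
    \<comment> \<open>The systems may overlap. Each row is assigned to one system containing it,
      which makes the parts disjoint and keeps their hereditary bounds.\<close>
    define c where "c j = (SOME k. k \<in> K \<and> j \<in> G k)" for j
    have c: "c j \<in> K \<and> j \<in> G (c j)" if "j \<in> F" for j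
      unfolding c_def by (rule someI_ex) (use that F in auto)
    define J where "J k = {j \<in> G k. c j = k}" for k
    have FJ: "F = (\<Union>k\<in>K. J k)"
    proof
      show "F \<subseteq> (\<Union>k\<in>K. J k)" using c unfolding J_def by blast
      show "(\<Union>k\<in>K. J k) \<subseteq> F" unfolding J_def F by blast
    qed
    have "Det I (add_id (gram (\<Union>k\<in>K. J k) v A))
        \<le> exp (2 * sqrt (144 * exp 2 * card I * card K * d\<^sup>2 * (W / \<mu>)))"
    proof (rule Det_add_id_gram_UN_le[OF assms(1,3)])
      show "finite (J k)" if "k \<in> K" for k using assms(4)[OF that] by (simp add: J_def)
      show "J k \<inter> J l = {}" if "k \<noteq> l" for k l using that by (auto simp: J_def)
      show "0 \<le> v j" if "k \<in> K" "j \<in> J k" for k j using v that FJ by blast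
      show "herdisc_le (J k) I A d" if "k \<in> K" for k
        using hd[OF that] by (rule herdisc_le_mono) (auto simp: J_def)
      show "W / \<mu> = (\<Sum>j\<in>(\<Union>k\<in>K. J k). v j)"
        unfolding FJ[symmetric] W(1) v_def by (rule sum_divide_distrib)
    qed (use d W \<mu> in auto)
    then show ?thesis by (simp only: FJ)
  qed
  also have "144 * exp 2 * card I * card K * d\<^sup>2 * (W / \<mu>) = (real (card I) / 100)\<^sup>2"
    unfolding \<mu>_def using K I d W by (simp add: field_simps power2_eq_square)
  also have "sqrt ((real (card I) / 100)\<^sup>2) = real (card I) / 100" by simp
  finally have "(3/2) ^ card I \<le> 2 * exp (2 * (real (card I) / 100))" by simp
  moreover have "2 * exp (real (card I) / 20) \<le> (3/2) ^ card I"
    by (rule exp_le_three_halves_power[OF assms(2)])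
  ultimately have "2 * exp (real (card I) / 20) \<le> 2 * exp (2 * (real (card I) / 100))"
    by linarith
  then show False using I by simp
qed

section \<open>Choosing the sign of a step\<close>

lemma cosh_le:
  fixes b :: real
  assumes "\<bar>b\<bar> \<le> 1"
  shows "cosh b \<le> 1 + b\<^sup>2"
proof -
  have *: "cosh b \<le> 1 + b\<^sup>2" if "0 \<le> b" "b \<le> 1" for b :: real
  proof -
    have "exp (- b) \<le> 1 / (1 + b)"
      using exp_ge_add_one_self[of b] that by (simp add: exp_minus field_simps)
    also have "\<dots> \<le> 1 - b + b\<^sup>2"
    proof -
      have "1 \<le> (1 - b + b\<^sup>2) * (1 + b)"
        using that by (simp add: algebra_simps power2_eq_square)
      then show ?thesis using that by (simp add: divide_le_eq)
    qed
    finally show ?thesis using exp_bound[OF that] by (simp add: cosh_def)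
  qed
  show ?thesis using *[of b] *[of "- b"] assms by (cases "0 \<le> b") auto
qed

text \<open>Averaging over both signs cancels the sinh terms, and one of the two signs does no worse
  than the average.\<close>

lemma cosh_step:
  fixes a b :: "'r \<Rightarrow> real"
  assumes "\<And>j. j \<in> F \<Longrightarrow> \<bar>b j\<bar> \<le> 1"
  shows "\<exists>\<sigma>\<in>{-1, 1}. (\<Sum>j\<in>F. cosh (a j + \<sigma> * b j))
    \<le> (\<Sum>j\<in>F. cosh (a j)) + (\<Sum>j\<in>F. cosh (a j) * (b j)\<^sup>2)"
proof -
  define B where "B = (\<Sum>j\<in>F. cosh (a j)) + (\<Sum>j\<in>F. cosh (a j) * (b j)\<^sup>2)"
  have "(\<Sum>j\<in>F. cosh (a j + 1 * b j)) + (\<Sum>j\<in>F. cosh (a j + (-1) * b j))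
      = (\<Sum>j\<in>F. 2 * (cosh (a j) * cosh (b j)))"
    unfolding sum.distrib[symmetric] by (intro sum.cong refl) (simp add: cosh_add cosh_diff)
  also have "\<dots> \<le> (\<Sum>j\<in>F. 2 * (cosh (a j) * (1 + (b j)\<^sup>2)))"
    using assms by (intro sum_mono mult_left_mono cosh_le) auto
  also have "\<dots> = 2 * B"
    by (simp add: B_def sum_distrib_left sum.distrib distrib_left)
  finally have "(\<Sum>j\<in>F. cosh (a j + 1 * b j)) \<le> B \<or> (\<Sum>j\<in>F. cosh (a j + (-1) * b j)) \<le> B"
    by arith
  then show ?thesis unfolding B_def by blast
qed

section \<open>The walk\<close>

locale disc_walk =
  fixes S :: "'c set" and F :: "'r set" and A :: "'r \<Rightarrow> 'c \<Rightarrow> real" and \<Lambda> \<eta> \<delta> :: real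
  assumes finS: "finite S" and finF: "finite F" "F \<noteq> {}"
    and A: "\<And>j e. j \<in> F \<Longrightarrow> e \<in> S \<Longrightarrow> \<bar>A j e\<bar> \<le> 1"
    and \<Lambda>: "0 < \<Lambda>" and \<eta>: "0 < \<eta>"
    and \<delta>: "0 < \<delta>" "2 * card S * \<delta> \<le> 1" "\<eta> * card S * \<delta> \<le> 1"
    and direction: "\<And>I w y. I \<subseteq> S \<Longrightarrow> 2 \<le> card I \<Longrightarrow> (\<And>j. j \<in> F \<Longrightarrow> 0 < w j) \<Longrightarrow>
      \<exists>x. (\<Sum>i\<in>I. x i * y i) = 0 \<and> 0 < (\<Sum>i\<in>I. (x i)\<^sup>2) \<and>
        qf I (gram F w A) x \<le> \<Lambda> * (\<Sum>j\<in>F. w j) / card I * (\<Sum>i\<in>I. (x i)\<^sup>2)"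
begin

definition energy :: "('c \<Rightarrow> real) \<Rightarrow> real" where
  "energy y = (\<Sum>e\<in>S. (y e)\<^sup>2)"

definition row :: "('c \<Rightarrow> real) \<Rightarrow> 'r \<Rightarrow> real" where
  "row y j = (\<Sum>e\<in>S. A j e * y e)"

definition potential :: "('c \<Rightarrow> real) \<Rightarrow> real" where
  "potential y = (\<Sum>j\<in>F. cosh (\<eta> * row y j))"

definition active :: "('c \<Rightarrow> real) \<Rightarrow> 'c set" where
  "active y = {e \<in> S. \<bar>y e\<bar> \<le> 1 - \<delta>}"

text \<open>With \<open>u = card S - energy y + 1\<close>, the exponent is the integral of 3
  \<eta>^2 \<Lambda> / u as \<open>u\<close> falls from \<open>card S + 1\<close>. The added 1 keeps
  the logarithm nonnegative throughout the cube.\<close>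

definition good :: "('c \<Rightarrow> real) \<Rightarrow> bool" where
  "good y \<longleftrightarrow> (\<forall>e\<in>S. \<bar>y e\<bar> \<le> 1) \<and>
     potential y \<le> card F * exp (3 * \<eta>\<^sup>2 * \<Lambda> * (ln (real (card S) + 1) - ln (card S - energy y + 1)))"

lemma energy_le:
  assumes "\<And>e. e \<in> S \<Longrightarrow> \<bar>y e\<bar> \<le> 1"
  shows "energy y \<le> card S"
proof -
  have "energy y \<le> (\<Sum>e\<in>S. 1)"
    unfolding energy_def using assms by (intro sum_mono) (simp add: abs_square_le_1)
  then show ?thesis by simp
qed

text \<open>An active coordinate misses at most 1 of its energy, a frozen one at most
  \<open>2 * \<delta>\<close>, and the latter sum to at most 1.\<close>

lemma missing_energy_le:
  assumes "good y"
  shows "card S - energy y \<le> card (active y) + 1"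
proof -
  have "card S - energy y = (\<Sum>e\<in>S. 1 - (y e)\<^sup>2)"
    by (simp add: energy_def sum_subtractf)
  also have "\<dots> \<le> (\<Sum>e\<in>S. of_bool (e \<in> active y) + 2 * \<delta>)"
  proof (rule sum_mono)
    fix e assume e: "e \<in> S"
    show "1 - (y e)\<^sup>2 \<le> of_bool (e \<in> active y) + 2 * \<delta>"
    proof (cases "e \<in> active y")
      case True
      have "1 - (y e)\<^sup>2 \<le> 1 + 2 * \<delta>" using \<delta>(1) zero_le_power2[of "y e"] by linarith
      then show ?thesis using True by simp
    next
      case False
      then have "1 - \<delta> < \<bar>y e\<bar>" using e by (simp add: active_def)
      then have "1 - 2 * \<bar>y e\<bar> + \<bar>y e\<bar>\<^sup>2 \<le> 2 * \<delta> - 1 + \<bar>y e\<bar>\<^sup>2" by simp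
      moreover have "0 \<le> (1 - \<bar>y e\<bar>)\<^sup>2" by simp
      ultimately show ?thesis using False by (simp add: power2_diff)
    qed
  qed
  also have "\<dots> = card (active y) + 2 * card S * \<delta>"
  proof -
    have "(\<Sum>e\<in>S. of_bool (e \<in> active y) :: real) = (\<Sum>e\<in>active y. 1)"
      using finS by (intro sum.mono_neutral_cong_right) (auto simp: active_def)
    then show ?thesis by (simp add: sum.distrib)
  qed
  finally show ?thesis using \<delta>(2) by linarith
qed

text \<open>A step of length \<open>\<delta>\<close> orthogonal to \<open>y\<close> raises the
  energy by exactly \<open>\<delta>\<^sup>2\<close>. The relative growth of the potential is at most
  \<open>\<eta>\<^sup>2 * \<Lambda> * \<delta>\<^sup>2 / k\<close>, which is charged to the drop in
  the logarithm of \<open>u\<close>.\<close>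

lemma step:
  assumes good: "good y" and act: "2 \<le> card (active y)"
  shows "\<exists>z. good z \<and> energy z = energy y + \<delta>\<^sup>2"
proof -
  define I where "I = active y"
  define k where "k = real (card I)"
  have I: "I \<subseteq> S" "finite I" using finS by (auto simp: I_def active_def)
  have k: "2 \<le> k" using act by (simp add: k_def I_def)
  define w where "w j = cosh (\<eta> * row y j)" for j
  have wpos: "0 < w j" for j by (simp add: w_def)
  obtain x0 where x0: "(\<Sum>i\<in>I. x0 i * y i) = 0" "0 < (\<Sum>i\<in>I. (x0 i)\<^sup>2)"
    "qf I (gram F w A) x0 \<le> \<Lambda> * (\<Sum>j\<in>F. w j) / k * (\<Sum>i\<in>I. (x0 i)\<^sup>2)"
    using direction[OF I(1), of w y] act wpos unfolding I_def k_def by blast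
  define r where "r = \<delta> / sqrt (\<Sum>i\<in>I. (x0 i)\<^sup>2)"
  have r: "r\<^sup>2 * (\<Sum>i\<in>I. (x0 i)\<^sup>2) = \<delta>\<^sup>2" using x0(2) by (simp add: r_def power_divide)
  define x where "x e = (if e \<in> I then r * x0 e else 0)" for e
  have xS: "(\<Sum>e\<in>S. f e * x e) = r * (\<Sum>e\<in>I. f e * x0 e)" for f
  proof -
    have "(\<Sum>e\<in>S. f e * x e) = (\<Sum>e\<in>I. r * (f e * x0 e))"
      using finS I by (intro sum.mono_neutral_cong_right) (auto simp: x_def)
    then show ?thesis by (simp add: sum_distrib_left)
  qed
  have x2: "(\<Sum>e\<in>S. (x e)\<^sup>2) = \<delta>\<^sup>2"
  proof -
    have "(\<Sum>e\<in>S. (x e)\<^sup>2) = (\<Sum>e\<in>I. r\<^sup>2 * (x0 e)\<^sup>2)"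
      using finS I by (intro sum.mono_neutral_cong_right) (auto simp: x_def power_mult_distrib)
    then show ?thesis using r by (simp add: sum_distrib_left)
  qed
  have xy: "(\<Sum>e\<in>S. y e * x e) = 0" using xS[of y] x0(1) by (simp add: mult.commute)
  have xle: "\<bar>x e\<bar> \<le> \<delta>" if "e \<in> S" for e
  proof -
    have "(x e)\<^sup>2 \<le> (\<Sum>e\<in>S. (x e)\<^sup>2)" using that finS by (intro member_le_sum) auto
    then show ?thesis unfolding x2 using \<delta>(1) by (simp add: abs_le_square_iff[symmetric])
  qed
  define b where "b j = \<eta> * row x j" for j
  have b1: "\<bar>b j\<bar> \<le> 1" if j: "j \<in> F" for j
  proof -
    have "\<bar>row x j\<bar> \<le> (\<Sum>e\<in>S. \<bar>A j e * x e\<bar>)" unfolding row_def by (rule sum_abs)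
    also have "\<dots> \<le> (\<Sum>e\<in>S. \<delta>)"
    proof (rule sum_mono)
      fix e assume e: "e \<in> S"
      have "\<bar>A j e\<bar> * \<bar>x e\<bar> \<le> 1 * \<delta>" using A[OF j e] xle[OF e] by (intro mult_mono) auto
      then show "\<bar>A j e * x e\<bar> \<le> \<delta>" by (simp add: abs_mult)
    qed
    finally have "\<eta> * \<bar>row x j\<bar> \<le> \<eta> * (card S * \<delta>)" using \<eta> by (intro mult_left_mono) auto
    also have "\<dots> \<le> 1" using \<delta>(3) by (simp only: mult.assoc)
    finally show ?thesis using \<eta> by (simp add: b_def abs_mult)
  qed
  have b2: "(\<Sum>j\<in>F. w j * (b j)\<^sup>2) \<le> \<eta>\<^sup>2 * \<Lambda> * \<delta>\<^sup>2 / k * potential y"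
  proof -
    have "(\<Sum>j\<in>F. w j * (b j)\<^sup>2) = (\<Sum>j\<in>F. (\<eta>\<^sup>2 * r\<^sup>2) * (w j * (\<Sum>i\<in>I. A j i * x0 i)\<^sup>2))"
      unfolding b_def row_def xS by (intro sum.cong refl) (simp add: power_mult_distrib)
    also have "\<dots> = (\<eta>\<^sup>2 * r\<^sup>2) * qf I (gram F w A) x0"
      unfolding qf_gram by (simp only: sum_distrib_left)
    also have "\<dots> \<le> (\<eta>\<^sup>2 * r\<^sup>2) * (\<Lambda> * (\<Sum>j\<in>F. w j) / k * (\<Sum>i\<in>I. (x0 i)\<^sup>2))"
      by (intro mult_left_mono x0(3)) auto
    also have "\<dots> = \<eta>\<^sup>2 * \<Lambda> * (r\<^sup>2 * (\<Sum>i\<in>I. (x0 i)\<^sup>2)) / k * potential y"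
      by (simp add: potential_def w_def)
    finally show ?thesis unfolding r .
  qed
  obtain \<sigma> :: real where \<sigma>: "\<sigma> \<in> {-1, 1}" and pot0: "(\<Sum>j\<in>F. cosh (\<eta> * row y j + \<sigma> * b j))
      \<le> (\<Sum>j\<in>F. cosh (\<eta> * row y j)) + (\<Sum>j\<in>F. cosh (\<eta> * row y j) * (b j)\<^sup>2)"
    using cosh_step[of F b "\<lambda>j. \<eta> * row y j", OF b1] by blast
  define z where "z e = y e + \<sigma> * x e" for e
  have \<sigma>2: "\<sigma>\<^sup>2 = 1" "\<bar>\<sigma>\<bar> = 1" using \<sigma> by auto
  have rowz: "row z j = row y j + \<sigma> * row x j" for j
    unfolding row_def z_def by (simp add: sum.distrib sum_distrib_left algebra_simps)
  \<comment> \<open>Only active coordinates move, and by at most \<open>\<delta>\<close>, so the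
    point stays in the cube.\<close>
  have z1: "\<bar>z e\<bar> \<le> 1" if e: "e \<in> S" for e
  proof (cases "e \<in> I")
    case True
    then have "\<bar>y e\<bar> \<le> 1 - \<delta>" by (simp add: I_def active_def)
    moreover have "\<bar>\<sigma> * x e\<bar> \<le> \<delta>" using xle[OF e] \<sigma>2 by (simp add: abs_mult)
    ultimately show ?thesis unfolding z_def by linarith
  next
    case False
    then show ?thesis using good e by (simp add: z_def x_def good_def)
  qed
  have Ez: "energy z = energy y + \<delta>\<^sup>2"
  proof -
    have "energy z = (\<Sum>e\<in>S. (y e)\<^sup>2 + 2 * \<sigma> * (y e * x e) + \<sigma>\<^sup>2 * (x e)\<^sup>2)"
      unfolding energy_def z_def by (intro sum.cong refl) (simp add: power2_sum power_mult_distrib)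
    also have "\<dots> = energy y + 2 * \<sigma> * (\<Sum>e\<in>S. y e * x e) + \<sigma>\<^sup>2 * (\<Sum>e\<in>S. (x e)\<^sup>2)"
      by (simp only: sum.distrib sum_distrib_left energy_def)
    finally show ?thesis using xy x2 \<sigma>2 by simp
  qed
  define u where "u = card S - energy y + 1"
  have u: "1 \<le> u - \<delta>\<^sup>2" using energy_le[of z, OF z1] Ez by (simp add: u_def)
  have u0: "0 < u" using u zero_le_power2[of \<delta>] by linarith
  have "\<delta>\<^sup>2 / k \<le> 3 * (ln u - ln (u - \<delta>\<^sup>2))"
  proof -
    \<comment> \<open>The missing energy is at most \<open>k + 1\<close>, so \<open>u\<close> is at
      most \<open>k + 2\<close>, and \<open>k\<close> is at least 2.\<close>
    have "u \<le> 3 * k"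
      using missing_energy_le[OF good] k by (simp add: u_def k_def I_def)
    then have "\<delta>\<^sup>2 / k \<le> 3 * (\<delta>\<^sup>2 / u)"
      using k u0 \<delta>(1) by (simp add: field_simps)
    also have "\<delta>\<^sup>2 / u \<le> ln u - ln (u - \<delta>\<^sup>2)"
    proof -
      have "ln ((u - \<delta>\<^sup>2) / u) \<le> (u - \<delta>\<^sup>2) / u - 1"
        using u u0 by (intro ln_le_minus_one) auto
      moreover have "ln ((u - \<delta>\<^sup>2) / u) = ln (u - \<delta>\<^sup>2) - ln u" using u u0 by (subst ln_div) auto
      moreover have "(u - \<delta>\<^sup>2) / u - 1 = - (\<delta>\<^sup>2 / u)" using u0 by (simp add: field_simps)
      ultimately show ?thesis by linarith
    qed
    finally show ?thesis by simp
  qed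
  then have "\<eta>\<^sup>2 * \<Lambda> * (\<delta>\<^sup>2 / k) \<le> \<eta>\<^sup>2 * \<Lambda> * (3 * (ln u - ln (u - \<delta>\<^sup>2)))"
    using \<Lambda> by (intro mult_left_mono) auto
  then have inc: "\<eta>\<^sup>2 * \<Lambda> * \<delta>\<^sup>2 / k \<le> 3 * \<eta>\<^sup>2 * \<Lambda> * (ln u - ln (u - \<delta>\<^sup>2))" by (simp only: mult_ac times_divide_eq_right times_divide_eq_left)
  have "potential z = (\<Sum>j\<in>F. cosh (\<eta> * row y j + \<sigma> * b j))"
    unfolding potential_def rowz b_def by (intro sum.cong refl arg_cong[where f = cosh]) (simp add: algebra_simps)
  also have "\<dots> \<le> potential y + \<eta>\<^sup>2 * \<Lambda> * \<delta>\<^sup>2 / k * potential y"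
    using pot0 b2 unfolding potential_def w_def by linarith
  also have "\<dots> = potential y * (1 + \<eta>\<^sup>2 * \<Lambda> * \<delta>\<^sup>2 / k)" by (simp add: algebra_simps)
  also have "\<dots> \<le> (card F * exp (3 * \<eta>\<^sup>2 * \<Lambda> * (ln (real (card S) + 1) - ln u))) *
      exp (3 * \<eta>\<^sup>2 * \<Lambda> * (ln u - ln (u - \<delta>\<^sup>2)))"
  proof (rule mult_mono)
    show "potential y \<le> card F * exp (3 * \<eta>\<^sup>2 * \<Lambda> * (ln (real (card S) + 1) - ln u))"
      using good by (simp add: good_def u_def)
    show "1 + \<eta>\<^sup>2 * \<Lambda> * \<delta>\<^sup>2 / k \<le> exp (3 * \<eta>\<^sup>2 * \<Lambda> * (ln u - ln (u - \<delta>\<^sup>2)))"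
      by (rule order_trans[OF exp_ge_add_one_self]) (use inc in simp)
  qed (use \<Lambda> k in auto)
  also have "\<dots> = card F * exp (3 * \<eta>\<^sup>2 * \<Lambda> * (ln (real (card S) + 1) - ln (u - \<delta>\<^sup>2)))"
    by (simp add: exp_add[symmetric] algebra_simps)
  also have "u - \<delta>\<^sup>2 = card S - energy z + 1" by (simp add: u_def Ez)
  finally have "good z" using z1 by (simp add: good_def)
  then show ?thesis using Ez by blast
qed

text \<open>Each step uses up \<open>\<delta>\<^sup>2\<close> of the missing energy, which cannot
  become negative, so \<open>N\<close> bounds the number of remaining steps.\<close>

lemma walk:
  assumes "good y" "card S - energy y \<le> real N * \<delta>\<^sup>2"
  shows "\<exists>z. good z \<and> card (active z) \<le> 1"
  using assms
proof (induction N arbitrary: y)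
  case 0
  show ?case
  proof (cases "card (active y) \<le> 1")
    case False
    then obtain z where z: "good z" "energy z = energy y + \<delta>\<^sup>2" using step[OF 0(1)] by fastforce
    have "energy z \<le> card S" using z(1) by (intro energy_le) (simp add: good_def)
    moreover have "0 < \<delta>\<^sup>2" using \<delta> by simp
    ultimately show ?thesis using 0(2) z(2) by simp
  qed (use 0 in blast)
next
  case (Suc N)
  show ?case
  proof (cases "card (active y) \<le> 1")
    case False
    then obtain z where z: "good z" "energy z = energy y + \<delta>\<^sup>2" using step[OF Suc.prems(1)] by fastforce
    show ?thesis using Suc.prems(2) z by (intro Suc.IH[OF z(1)]) (simp add: algebra_simps)
  qed (use Suc in blast)
qed

text \<open>A single cosh is at most the whole potential, and \<open>exp \<bar>s\<bar>\<close> is at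
  most twice \<open>cosh s\<close>; taking logarithms gives the bound.\<close>

lemma row_le:
  assumes "good y" "j \<in> F"
  shows "\<bar>row y j\<bar> \<le> ln (2 * card F) / \<eta> + 3 * \<eta> * \<Lambda> * ln (real (card S) + 1)"
proof -
  have m: "0 < card F" using finF by (simp add: card_gt_0_iff)
  have "energy y \<le> card S" using assms by (intro energy_le) (simp add: good_def)
  then have l: "0 \<le> ln (card S - energy y + 1)" by simp
  have "exp (\<eta> * \<bar>row y j\<bar>) \<le> 2 * cosh (\<eta> * \<bar>row y j\<bar>)" by (simp add: cosh_def)
  also have "cosh (\<eta> * \<bar>row y j\<bar>) = cosh (\<eta> * row y j)"
    using cosh_real_abs[of "\<eta> * row y j"] \<eta> by (simp add: abs_mult)
  also have "\<dots> \<le> potential y"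
    unfolding potential_def using finF assms(2) by (intro member_le_sum) auto
  also have "\<dots> \<le> card F * exp (3 * \<eta>\<^sup>2 * \<Lambda> * (ln (real (card S) + 1) - ln (card S - energy y + 1)))"
    using assms(1) by (simp add: good_def)
  also have "\<dots> \<le> card F * exp (3 * \<eta>\<^sup>2 * \<Lambda> * ln (real (card S) + 1))"
    using l \<Lambda> by (intro mult_left_mono) (auto intro!: mult_left_mono)
  also have "2 * \<dots> = exp (ln (2 * card F) + 3 * \<eta>\<^sup>2 * \<Lambda> * ln (real (card S) + 1))"
    using m by (simp add: exp_add)
  finally have "\<eta> * \<bar>row y j\<bar> \<le> ln (2 * card F) + 3 * \<eta>\<^sup>2 * \<Lambda> * ln (real (card S) + 1)" by simp
  then show ?thesis using \<eta> by (simp add: field_simps power2_eq_square)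
qed

text \<open>Rounding the end of the walk to signs moves each frozen coordinate by at most
  \<open>\<delta>\<close> and the at most one active coordinate by at most 1. Entries of
  \<open>A\<close> are bounded by 1, so every row changes by at most 2.\<close>

lemma coloring:
  "\<exists>\<chi>. (\<forall>e\<in>S. \<chi> e \<in> {-1, 1}) \<and>
    (\<forall>j\<in>F. \<bar>\<Sum>e\<in>S. A j e * \<chi> e\<bar> \<le> ln (2 * card F) / \<eta> + 3 * \<eta> * \<Lambda> * ln (real (card S) + 1) + 2)"
proof -
  have "good (\<lambda>_. 0)" by (simp add: good_def potential_def row_def energy_def)
  moreover obtain N where "card S - energy (\<lambda>_. 0) < real N * \<delta>\<^sup>2"
    using reals_Archimedean3[of "\<delta>\<^sup>2"] \<delta>(1) by auto
  ultimately obtain y where y: "good y" "card (active y) \<le> 1"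
    using walk[of "\<lambda>_. 0" N] by auto
  define \<chi> :: "'c \<Rightarrow> real" where "\<chi> e = (if 0 \<le> y e then 1 else -1)" for e
  have diff: "\<bar>\<chi> e - y e\<bar> \<le> of_bool (e \<in> active y) + \<delta>" if e: "e \<in> S" for e
  proof -
    have "\<bar>y e\<bar> \<le> 1" using y(1) e by (simp add: good_def)
    moreover have "1 - \<delta> < \<bar>y e\<bar>" if "e \<notin> active y" using that e by (simp add: active_def)
    ultimately show ?thesis using \<delta>(1) unfolding \<chi>_def by (cases "e \<in> active y") auto
  qed
  have "\<bar>\<Sum>e\<in>S. A j e * \<chi> e\<bar> \<le> ln (2 * card F) / \<eta> + 3 * \<eta> * \<Lambda> * ln (real (card S) + 1) + 2"
    if j: "j \<in> F" for j
  proof -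
    have "\<bar>\<Sum>e\<in>S. A j e * (\<chi> e - y e)\<bar> \<le> (\<Sum>e\<in>S. \<bar>A j e * (\<chi> e - y e)\<bar>)" by (rule sum_abs)
    also have "\<dots> \<le> (\<Sum>e\<in>S. of_bool (e \<in> active y) + \<delta>)"
    proof (rule sum_mono)
      fix e assume e: "e \<in> S"
      have "\<bar>A j e\<bar> * \<bar>\<chi> e - y e\<bar> \<le> 1 * (of_bool (e \<in> active y) + \<delta>)"
        using A[OF j e] diff[OF e] \<delta>(1) by (intro mult_mono) auto
      then show "\<bar>A j e * (\<chi> e - y e)\<bar> \<le> of_bool (e \<in> active y) + \<delta>" by (simp add: abs_mult)
    qed
    also have "\<dots> = card (active y) + card S * \<delta>"
    proof -
      have "(\<Sum>e\<in>S. of_bool (e \<in> active y) :: real) = (\<Sum>e\<in>active y. 1)"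
        using finS by (intro sum.mono_neutral_cong_right) (auto simp: active_def)
      then show ?thesis by (simp add: sum.distrib)
    qed
    also have "\<dots> \<le> 2"
    proof -
      have "real (card (active y)) \<le> 1" using y(2) by simp
      then show ?thesis using \<delta>(1,2) by linarith
    qed
    finally have "\<bar>\<Sum>e\<in>S. A j e * (\<chi> e - y e)\<bar> \<le> 2" .
    moreover have "(\<Sum>e\<in>S. A j e * \<chi> e) = row y j + (\<Sum>e\<in>S. A j e * (\<chi> e - y e))"
      unfolding row_def by (simp add: sum.distrib[symmetric] algebra_simps)
    ultimately show ?thesis using row_le[OF y(1) j] by linarith
  qed
  moreover have "\<forall>e\<in>S. \<chi> e \<in> {-1, 1}" by (simp add: \<chi>_def)
  ultimately show ?thesis by blast
qed

end

section \<open>Hereditary discrepancy of a union\<close>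

lemma linf_norm_le_iff:
  assumes "finite I" "0 \<le> B"
  shows "linf_norm I v \<le> B \<longleftrightarrow> (\<forall>i\<in>I. \<bar>v i\<bar> \<le> B)"
  using assms by (simp add: linf_norm_def)

lemma finite_colorings: "finite T \<Longrightarrow> finite (T \<rightarrow>\<^sub>E {-1, 1 :: real})"
  by (intro finite_PiE) auto

lemma herdisc_imp_herdisc_le:
  assumes "finite J" "finite V" "herdisc J V A \<le> d"
  shows "herdisc_le J V A d"
  unfolding herdisc_le_def
proof (intro allI impI)
  fix T assume T: "T \<subseteq> V"
  then have finT: "finite T" using assms(2) finite_subset by blast
  let ?f = "\<lambda>x. linf_norm J (mat_apply T A x)"
  have "disc J T A \<in> ?f ` (T \<rightarrow>\<^sub>E {-1, 1})"
    unfolding disc_def using finT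
    by (intro Min_in finite_imageI finite_colorings) (auto simp: PiE_eq_empty_iff)
  then obtain x where x: "x \<in> T \<rightarrow>\<^sub>E {-1, 1}" "disc J T A = ?f x" by auto
  have "disc J T A \<le> herdisc J V A"
    unfolding herdisc_def using assms(2) T by (intro Max_ge) auto
  then have le: "?f x \<le> d" using assms(3) x(2) by linarith
  have "0 \<le> ?f x" unfolding linf_norm_def using assms(1) by (intro Max_ge) auto
  then have rows: "\<forall>j\<in>J. \<bar>mat_apply T A x j\<bar> \<le> d"
    using le linf_norm_le_iff[OF assms(1), of d] by simp
  define \<chi> where "\<chi> e = (if x e = 1 then 1 else -1 :: int)" for e
  have "real_of_int (\<chi> e) = x e" if "e \<in> T" for e
    using PiE_mem[OF x(1) that] by (auto simp: \<chi>_def)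
  then have "(\<Sum>e\<in>T. A j e * real_of_int (\<chi> e)) = mat_apply T A x j" for j
    unfolding mat_apply_def by (intro sum.cong) auto
  then show "\<exists>\<chi> :: 'b \<Rightarrow> int. (\<forall>e\<in>T. \<chi> e \<in> {-1, 1}) \<and>
      (\<forall>j\<in>J. \<bar>\<Sum>e\<in>T. A j e * real_of_int (\<chi> e)\<bar> \<le> d)"
    using rows by (intro exI[of _ \<chi>]) (simp add: \<chi>_def)
qed

lemma disc_le:
  assumes "finite J" "finite T" "0 \<le> B" "\<And>e. e \<in> T \<Longrightarrow> \<chi> e \<in> {-1, 1}"
    "\<And>j. j \<in> J \<Longrightarrow> \<bar>\<Sum>e\<in>T. A j e * \<chi> e\<bar> \<le> B"
  shows "disc J T A \<le> B"
proof -
  let ?f = "\<lambda>x. linf_norm J (mat_apply T A x)"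
  have "mat_apply T A (restrict \<chi> T) j = (\<Sum>e\<in>T. A j e * \<chi> e)" for j
    unfolding mat_apply_def by (intro sum.cong) auto
  then have "?f (restrict \<chi> T) \<le> B"
    using assms by (simp add: linf_norm_le_iff)
  moreover have "restrict \<chi> T \<in> T \<rightarrow>\<^sub>E {-1, 1}" using assms(4) by auto
  then have "disc J T A \<le> ?f (restrict \<chi> T)"
    unfolding disc_def using assms(2) by (intro Min_le finite_imageI finite_colorings imageI)
  ultimately show ?thesis by linarith
qed

lemma herdisc_le_bound:
  assumes "finite V" "\<And>T. T \<subseteq> V \<Longrightarrow> disc J T A \<le> B"
  shows "herdisc J V A \<le> B"
  unfolding herdisc_def using assms by (subst Max_le_iff) auto

text \<open>Restricted to a single element of \<open>X\<close>, the row of \<open>X\<close>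
  evaluates to 1 or -1. This lower bound lets additive constants be absorbed later.\<close>

lemma one_le_herdisc_sets:
  assumes "set_system_on n G" "X \<in> G" "X \<noteq> {}"
  shows "1 \<le> herdisc_sets n G"
proof -
  have finG: "finite G" using assms(1) unfolding set_system_on_def by (rule finite_subset) simp
  obtain e where e: "e \<in> X" using assms(3) by blast
  then have en: "{e} \<subseteq> {1..n}" using assms(1,2) unfolding set_system_on_def by blast
  have "herdisc_le G {1..n} incidence (herdisc_sets n G)"
    using finG by (intro herdisc_imp_herdisc_le) (auto simp: herdisc_sets_def)
  then obtain \<chi> :: "nat \<Rightarrow> int" where "\<chi> e \<in> {-1, 1}"
    and "\<bar>\<Sum>a\<in>{e}. incidence X a * real_of_int (\<chi> a)\<bar> \<le> herdisc_sets n G"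
    unfolding herdisc_le_def using en assms(2) by (metis singletonI)
  then show ?thesis using e by (auto simp: incidence_def)
qed

text \<open>The direction bound makes the walk available, and its row bound has the form
  \<open>a / \<eta> + \<eta> * b + 2\<close>.\<close>

lemma disc_union_le:
  fixes A :: "'r \<Rightarrow> 'c \<Rightarrow> real"
  assumes S: "finite S" "S \<noteq> {}" and K: "finite K" "\<And>k. k \<in> K \<Longrightarrow> finite (G k)"
    and F: "F = (\<Union>k\<in>K. G k)" "F \<noteq> {}"
    and A: "\<And>j e. j \<in> F \<Longrightarrow> e \<in> S \<Longrightarrow> \<bar>A j e\<bar> \<le> 1"
    and hd: "\<And>k. k \<in> K \<Longrightarrow> herdisc_le (G k) S A d" and d: "0 < d"
  shows "disc F S A
    \<le> 2 * sqrt (3 * (1440000 * exp 2 * card K * d\<^sup>2) * ln (2 * card F) * ln (real (card S) + 1)) + 2"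
proof -
  have finF: "finite F" using K F by auto
  have m: "1 \<le> card F" using finF F(2) by (simp add: Suc_le_eq card_gt_0_iff)
  have s: "1 \<le> card S" using S by (simp add: Suc_le_eq card_gt_0_iff)
  have t: "0 < card K" using F K(1) by (auto simp: card_gt_0_iff)
  define \<Lambda> where "\<Lambda> = 1440000 * exp 2 * card K * d\<^sup>2"
  have \<Lambda>: "0 < \<Lambda>" using t d by (simp add: \<Lambda>_def)
  define a where "a = ln (2 * real (card F))"
  define b where "b = 3 * \<Lambda> * ln (real (card S) + 1)"
  have a: "0 < a" using m by (simp add: a_def)
  have b: "0 < b" using s \<Lambda> by (simp add: b_def)
  \<comment> \<open>The minimiser of \<open>a / \<eta> + \<eta> * b\<close>, at which both terms
    equal \<open>sqrt (a * b)\<close>.\<close>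
  define \<eta> where "\<eta> = sqrt (a / b)"
  have \<eta>: "0 < \<eta>" using a b by (simp add: \<eta>_def)
  define \<delta> where "\<delta> = min (1 / (2 * card S)) (1 / (\<eta> * card S))"
  have \<delta>: "0 < \<delta>" "\<delta> \<le> 1 / (2 * card S)" "\<delta> \<le> 1 / (\<eta> * card S)" using s \<eta> by (auto simp: \<delta>_def)
  interpret disc_walk S F A \<Lambda> \<eta> \<delta>
  proof
    show "2 * card S * \<delta> \<le> 1" using \<delta>(2) s by (simp add: field_simps)
    show "\<eta> * card S * \<delta> \<le> 1" using \<delta>(3) s \<eta> by (simp add: field_simps)
    fix I :: "'c set" and w :: "'r \<Rightarrow> real" and y :: "'c \<Rightarrow> real"
    assume I: "I \<subseteq> S" "2 \<le> card I" and w: "\<And>j. j \<in> F \<Longrightarrow> 0 < w j"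
    have "0 < (\<Sum>j\<in>F. w j)" using w finF F(2) by (intro sum_pos) auto
    moreover have "finite I" using I S finite_subset by blast
    moreover have "herdisc_le (G k) I A d" if "k \<in> K" for k
      using hd[OF that] I(1) by (rule herdisc_le_mono[OF _ subset_refl]) simp
    moreover have "0 \<le> w j" if "j \<in> F" for j using w[OF that] by simp
    ultimately show "\<exists>x. (\<Sum>i\<in>I. x i * y i) = 0 \<and> 0 < (\<Sum>i\<in>I. (x i)\<^sup>2) \<and>
        qf I (gram F w A) x \<le> \<Lambda> * (\<Sum>j\<in>F. w j) / card I * (\<Sum>i\<in>I. (x i)\<^sup>2)"
      unfolding \<Lambda>_def using K F(1) d I(2)
      by (intro small_direction[of I K G F w "sum w F" A d y]) simp_all
  qed (use S finF F(2) A \<Lambda> \<eta> \<delta> in auto)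
  have ab: "a / \<eta> + \<eta> * b = 2 * sqrt (a * b)"
  proof -
    have "\<eta> * b = sqrt (a * b)"
    proof -
      have "\<eta> * b = sqrt (a / b) * sqrt (b\<^sup>2)" using b by (simp add: \<eta>_def)
      also have "\<dots> = sqrt (a / b * b\<^sup>2)" by (simp only: real_sqrt_mult)
      finally show ?thesis using b by (simp add: power2_eq_square)
    qed
    moreover have "a / \<eta> = \<eta> * b"
    proof -
      have "\<eta> * \<eta> = a / b" using a b by (simp add: \<eta>_def)
      then show ?thesis using \<eta> b by (simp add: field_simps)
    qed
    ultimately show ?thesis by simp
  qed
  obtain \<chi> where \<chi>: "\<forall>e\<in>S. \<chi> e \<in> {-1, 1}"
    "\<forall>j\<in>F. \<bar>\<Sum>e\<in>S. A j e * \<chi> e\<bar> \<le> ln (2 * card F) / \<eta> + 3 * \<eta> * \<Lambda> * ln (real (card S) + 1) + 2"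
    using coloring by blast
  have eq: "ln (2 * card F) / \<eta> + 3 * \<eta> * \<Lambda> * ln (real (card S) + 1) + 2 = 2 * sqrt (a * b) + 2"
    using ab by (simp add: a_def b_def mult_ac)
  have "disc F S A \<le> 2 * sqrt (a * b) + 2"
    using \<chi> finF S(1) a b unfolding eq by (intro disc_le[where \<chi> = \<chi>]) auto
  also have "a * b = 3 * \<Lambda> * ln (2 * card F) * ln (real (card S) + 1)"
    by (simp add: a_def b_def mult_ac)
  finally show ?thesis by (simp add: \<Lambda>_def)
qed

theorem theorem3:
  "\<exists>C::real. C > 0 \<and>
     (\<forall>(n::nat) (m::nat) (t::nat) (F :: nat set set) (G :: nat \<Rightarrow> nat set set).
        n \<ge> 2 \<longrightarrow> m \<ge> 2 \<longrightarrow> t \<ge> 1 \<longrightarrow>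
        set_system_on n F \<longrightarrow> card F = m \<longrightarrow>
        (\<forall>i\<in>{1..t}. set_system_on n (G i)) \<longrightarrow>
        F = (\<Union>i\<in>{1..t}. G i) \<longrightarrow>
        herdisc_sets n F
          \<le> C * sqrt (real t * ln (real m) * ln (real n))
              * Max ((\<lambda>i. herdisc_sets n (G i)) ` {1..t}))"
proof -
  define c :: real where "c = 3 * 1440000 * exp 2"
  have c: "0 < c" by (simp add: c_def)
  \<comment> \<open>The first summand comes from the root in the union bound, with a factor 2 from
    enlarging each of the two logarithms. The second absorbs the additive 2, since
    \<open>sqrt L * d\<close> is at least 1/2.\<close>
  define C where "C = 4 * sqrt c + 4"
  show ?thesis
  proof (intro exI[of _ C] conjI allI impI)
    show "0 < C" using c by (simp add: C_def add_pos_pos)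
    fix n m t :: nat and F :: "nat set set" and G :: "nat \<Rightarrow> nat set set"
    assume n: "n \<ge> 2" and m: "m \<ge> 2" and t: "t \<ge> 1" and Fn: "set_system_on n F" and cF: "card F = m"
      and Gn: "\<forall>i\<in>{1..t}. set_system_on n (G i)" and FG: "F = (\<Union>i\<in>{1..t}. G i)"
    define d where "d = Max ((\<lambda>i. herdisc_sets n (G i)) ` {1..t})"
    have finF: "finite F" using cF m by (intro card_ge_0_finite) simp
    have finG: "finite (G i)" if "i \<in> {1..t}" for i
      using finF that unfolding FG by (auto intro: finite_subset)
    have dG: "herdisc_sets n (G i) \<le> d" if "i \<in> {1..t}" for i
      unfolding d_def using that by (intro Max_ge) auto
    have d1: "1 \<le> d"
    proof -
      \<comment> \<open>At least two distinct sets cannot all be empty, so some system has a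
        nonempty member.\<close>
      have "\<not> F \<subseteq> {{}}" using cF m card_mono[of "{{}}" F] by fastforce
      then obtain X i where "X \<noteq> {}" "X \<in> G i" "i \<in> {1..t}" unfolding FG by blast
      then show ?thesis using one_le_herdisc_sets[of n "G i" X] Gn dG[of i] by fastforce
    qed
    define L where "L = real t * ln (real m) * ln (real n)"
    \<comment> \<open>Read off from ln (1/2) <= 1/2 - 1.\<close>
    have ln2: "1/2 \<le> ln (2::real)" using ln_le_minus_one[of "1/2 :: real"] by (simp add: ln_div)
    have lnm: "1/2 \<le> ln (real m)" by (rule order_trans[OF ln2 ln_mono]) (use m in auto)
    have lnn: "1/2 \<le> ln (real n)" by (rule order_trans[OF ln2 ln_mono]) (use n in auto)
    have L: "1/4 \<le> L"
    proof -
      have "1 * (1/2) * (1/2) \<le> real t * ln (real m) * ln (real n)"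
        using t lnm lnn by (intro mult_mono) auto
      then show ?thesis by (simp add: L_def)
    qed
    have "disc F S incidence \<le> C * sqrt L * d" if S: "S \<subseteq> {1..n}" for S
    proof (cases "S = {}")
      case True
      have "0 \<le> C * sqrt L * d" using L d1 \<open>0 < C\<close> by simp
      then show ?thesis
        unfolding True using finF by (intro disc_le) auto
    next
      case False
      have finS: "finite S" using S finite_subset by blast
      have cS: "card S \<le> n" using card_mono[OF _ S] by simp
      have "disc F S incidence
          \<le> 2 * sqrt (3 * (1440000 * exp 2 * card {1..t} * d\<^sup>2) * ln (2 * card F) * ln (real (card S) + 1)) + 2"
      proof (rule disc_union_le[OF finS False _ finG FG])
        show "F \<noteq> {}" using cF m by auto
        show "herdisc_le (G k) S incidence d" if "k \<in> {1..t}" for k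
        proof (rule herdisc_le_mono[OF _ subset_refl S order_refl])
          show "herdisc_le (G k) {1..n} incidence d"
            using dG[OF that] finG[OF that]
            by (intro herdisc_imp_herdisc_le) (auto simp: herdisc_sets_def)
        qed
      qed (use d1 in \<open>auto simp: incidence_def\<close>)
      also have "3 * (1440000 * exp 2 * card {1..t} * d\<^sup>2) * ln (2 * card F) * ln (real (card S) + 1)
          = (c * t * d\<^sup>2) * (ln (2 * real m) * ln (real (card S) + 1))"
        by (simp add: c_def cF mult_ac)
      \<comment> \<open>Here \<open>2 * m \<le> m * m\<close> and
        \<open>card S + 1 \<le> n * n\<close>, by \<open>m \<ge> 2\<close>, \<open>n \<ge> 2\<close>
        and \<open>card S \<le> n\<close>.\<close>
      also have "2 * sqrt \<dots> + 2 \<le> 2 * sqrt ((c * t * d\<^sup>2) * ((2 * ln (real m)) * (2 * ln (real n)))) + 2"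
      proof -
        have "ln (2 * real m) \<le> 2 * ln (real m)"
          using m ln_mono[of "2 * real m" "real m * real m"] by (simp add: ln_mult)
        moreover have "ln (real (card S) + 1) \<le> 2 * ln (real n)"
        proof -
          have "real (card S) + 1 \<le> real n + 1" using cS by simp
          also have "\<dots> \<le> real n * 2" using n by simp
          also have "\<dots> \<le> real n * real n" using n by (intro mult_left_mono) auto
          finally have "ln (real (card S) + 1) \<le> ln (real n * real n)" by (intro ln_mono) auto
          then show ?thesis using n by (simp add: ln_mult)
        qed
        ultimately have "ln (2 * real m) * ln (real (card S) + 1) \<le> (2 * ln (real m)) * (2 * ln (real n))"
          using m n by (intro mult_mono) auto
        then have "(c * t * d\<^sup>2) * (ln (2 * real m) * ln (real (card S) + 1))
            \<le> (c * t * d\<^sup>2) * ((2 * ln (real m)) * (2 * ln (real n)))"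
          using c by (intro mult_left_mono) auto
        then show ?thesis by simp
      qed
      also have "(c * t * d\<^sup>2) * ((2 * ln (real m)) * (2 * ln (real n))) = 2\<^sup>2 * (c * L * d\<^sup>2)"
        by (simp add: L_def mult_ac)
      also have "2 * sqrt (2\<^sup>2 * (c * L * d\<^sup>2)) + 2 = 4 * sqrt c * sqrt L * d + 2"
        using d1 by (simp add: real_sqrt_mult)
      also have "\<dots> \<le> 4 * sqrt c * sqrt L * d + 4 * (sqrt L * d)"
      proof -
        have "sqrt (1/4) \<le> sqrt L" using L by (rule real_sqrt_le_mono)
        then have "1/2 \<le> sqrt L" by (simp add: real_sqrt_divide)
        then have "1/2 * 1 \<le> sqrt L * d" using d1 L by (intro mult_mono) auto
        then show ?thesis by (simp add: mult_ac)
      qed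
      also have "\<dots> = C * sqrt L * d" by (simp add: C_def algebra_simps)
      finally show ?thesis .
    qed
    then show "herdisc_sets n F \<le> C * sqrt (real t * ln (real m) * ln (real n))
        * Max ((\<lambda>i. herdisc_sets n (G i)) ` {1..t})"
      unfolding herdisc_sets_def L_def d_def by (intro herdisc_le_bound) auto
  qed
qed

end
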